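(* Let $m>1$, $n>1$ and $p\ge 1$ be integers with $p\mid m$, and let $\ell$ be a prime divisor of the order of $G(m,p,n)$. Let the base-$\ell$ expression of $n$ be $(b_kb_{k-1}\dots b_1b_0)_\ell$. (i) If $\ell\mid m$, then the $\ell$-Sylow class of parabolic subgroups of $G(m,p,n)$ has the unique element $G(m,p,n)$. (ii) If $\ell\nmid m$, then the $\ell$-Sylow class of parabolic subgroups of $G(m,p,n)$ consists of the $G(m,p,n)$-conjugates of $\prod_{i=1}^{k} G(1,1,\ell^i)^{b_i}$.
   Context: A complex reflection of a complex vector space $V$ is a linear transformation of $V$ of finite order whose fixed space is a hyperplane; a unitary reflection group on $V$ is a finite subgroup of $GL(V)$ generated by complex reflections. The group $G(m,p,n)$: let $V$ be an $n$-dimensional complex vector space with orthonormal basis $e_1,\dots,e_n$, let $\mu_m$ be the group of $m$th roots of unity in $\mathbb{C}$, and let $p\mid m$. For $\theta:\{1,\dots,n\}\to\mu_m$ let $\hat\theta$ be the linear transformation with $\hat\theta(e_i)=\theta(i)e_i$. Let $A(m,p,n)$ be the group of all $\hat\theta$ with $\prod_{i=1}^n\theta(i)^{m/p}=1$. Let $\pi\in\mathrm{Sym}(n)$ act on $V$ by $\pi(e_i)=e_{\pi(i)}$. Then $G(m,p,n)=A(m,p,n)\rtimes\mathrm{Sym}(n)$, a unitary reflection group on $V$ of order $m^n n!/p$. In particular $G(1,1,r)\cong \mathrm{Sym}(r)$ acts by permutation matrices. Base-$\ell$ expression: $n=\sum_{i=0}^k b_i\ell^i$ with $0\le b_i<\ell$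 and $b_k\neq 0$. The product $\prod_{i=1}^{k} G(1,1,\ell^i)^{b_i}$ denotes the subgroup of $G(1,1,n)=\mathrm{Sym}(n)\le G(m,p,n)$ obtained by choosing disjoint subsets of the basis $\{e_1,\dots,e_n\}$, with exactly $b_i$ of them of size $\ell^i$ for each $1\le i\le k$, and letting each factor $G(1,1,\ell^i)$ act as the full symmetric group on the corresponding subset (the remaining $b_0$ basis vectors being fixed). A parabolic subgroup of a unitary reflection group $G$ on $V$ is the pointwise stabiliser $G_U$ of some subspace $U$ of $V$. For a prime $\ell$ dividing $|G|$, the $\ell$-Sylow class of parabolic subgroups of $G$ is the set of parabolic subgroups that are minimal with respect to inclusion subject to containing an $\ell$-Sylow subgroup of $G$; this set is a single $G$-conjugacy class. *)

theory Defs
  imports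
    "HOL-Analysis.Analysis"
    "HOL-Algebra.Coset"
    "HOL-Computational_Algebra.Primes"
    "HOL-Combinatorics.Permutations"
    "HOL-Library.Disjoint_Sets"
begin

text \<open>
  The \<open>n\<close>-dimensional space \<open>V\<close> is \<^typ>\<open>complex ^ 'n\<close> with \<open>n = CARD('n)\<close>, and the
  orthonormal basis is the standard one, \<open>e\<^sub>i = axis i 1\<close>, indexed by \<open>'n\<close>.
  Linearity and subspaces are over the complex numbers, hence taken with respect to \<open>(*s)\<close>:
  the unqualified \<open>linear\<close> and \<open>subspace\<close> would refer to the real scalars.
\<close>

definition GL :: "(complex ^ 'n \<Rightarrow> complex ^ 'n) monoid" where
  "GL = \<lparr>carrier = {f. Vector_Spaces.linear (*s) (*s) f \<and> bij f}, mult = (\<circ>), one = id\<rparr>"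

text \<open>The linear transformation with \<open>e\<^sub>i \<mapsto> f i\<close>.\<close>

definition basis_ext :: "('n \<Rightarrow> complex ^ 'n) \<Rightarrow> complex ^ 'n \<Rightarrow> complex ^ 'n" where
  "basis_ext f v = (\<Sum>i\<in>UNIV. (v $ i) *s f i)"

lemma linear_basis_ext: "Vector_Spaces.linear (*s) (*s) (basis_ext f)"
  by (auto simp: Vector_Spaces.linear_iff vec.vector_space_axioms basis_ext_def vec_eq_iff
        sum.distrib sum_distrib_left algebra_simps)

lemma basis_ext_axis [simp]: "basis_ext f (axis i 1) = f i"
proof -
  have "basis_ext f (axis i 1) = (\<Sum>j\<in>UNIV. if j = i then f j else 0)"
    unfolding basis_ext_def by (intro sum.cong) (auto simp: axis_def vec_eq_iff)
  then show ?thesis by simp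
qed

definition diag_map :: "('n \<Rightarrow> complex) \<Rightarrow> complex ^ 'n \<Rightarrow> complex ^ 'n" where
  "diag_map \<theta> = basis_ext (\<lambda>i. \<theta> i *s axis i 1)"

definition perm_map :: "('n \<Rightarrow> 'n) \<Rightarrow> complex ^ 'n \<Rightarrow> complex ^ 'n" where
  "perm_map \<pi> = basis_ext (\<lambda>i. axis (\<pi> i) 1)"

definition A_group :: "nat \<Rightarrow> nat \<Rightarrow> (complex ^ 'n \<Rightarrow> complex ^ 'n) set" where
  "A_group m p =
     diag_map ` {\<theta>. (\<forall>i. \<theta> i ^ m = 1) \<and> (\<Prod>i\<in>UNIV. \<theta> i ^ (m div p)) = 1}"

definition Sym_group :: "(complex ^ 'n \<Rightarrow> complex ^ 'n) set" where
  "Sym_group = perm_map ` {\<pi>. \<pi> permutes UNIV}"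

text \<open>The semidirect product is the internal one, inside \<^const>\<open>GL\<close>.\<close>

definition imprim_group :: "nat \<Rightarrow> nat \<Rightarrow> (complex ^ 'n \<Rightarrow> complex ^ 'n) monoid" where
  "imprim_group m p = GL\<lparr>carrier := A_group m p <#>\<^bsub>GL\<^esub> Sym_group\<rparr>"

definition parabolic_subgroup ::
    "(complex ^ 'n \<Rightarrow> complex ^ 'n) monoid \<Rightarrow> (complex ^ 'n \<Rightarrow> complex ^ 'n) set \<Rightarrow> bool" where
  "parabolic_subgroup G P \<longleftrightarrow>
     (\<exists>U. vec.subspace U \<and> P = {g \<in> carrier G. \<forall>u\<in>U. g u = u})"

definition sylow_subgroup :: "nat \<Rightarrow> ('a, 'b) monoid_scheme \<Rightarrow> 'a set \<Rightarrow> bool" where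
  "sylow_subgroup l G S \<longleftrightarrow> subgroup S G \<and> card S = l ^ multiplicity l (Coset.order G)"

definition contains_sylow :: "nat \<Rightarrow> ('a, 'b) monoid_scheme \<Rightarrow> 'a set \<Rightarrow> bool" where
  "contains_sylow l G P \<longleftrightarrow> (\<exists>S. sylow_subgroup l G S \<and> S \<subseteq> P)"

definition sylow_parabolic_class ::
    "nat \<Rightarrow> (complex ^ 'n \<Rightarrow> complex ^ 'n) monoid \<Rightarrow> (complex ^ 'n \<Rightarrow> complex ^ 'n) set set" where
  "sylow_parabolic_class l G =
     {P. parabolic_subgroup G P \<and> contains_sylow l G P \<and>
         (\<forall>Q. parabolic_subgroup G Q \<and> contains_sylow l G Q \<and> Q \<subseteq> P \<longrightarrow> Q = P)}"

definition conjugates :: "('a, 'b) monoid_scheme \<Rightarrow> 'a set \<Rightarrow> 'a set set" where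
  "conjugates G H = {(g <#\<^bsub>G\<^esub> H) #>\<^bsub>G\<^esub> (inv\<^bsub>G\<^esub> g) | g. g \<in> carrier G}"

definition base_expression :: "nat \<Rightarrow> nat \<Rightarrow> nat \<Rightarrow> (nat \<Rightarrow> nat) \<Rightarrow> bool" where
  "base_expression l n k b \<longleftrightarrow>
     n = (\<Sum>i\<le>k. b i * l ^ i) \<and> (\<forall>i\<le>k. b i < l) \<and> b k \<noteq> 0"

text \<open>
  A choice of disjoint sets of basis vectors, exactly \<open>b i\<close> of them of size \<open>l ^ i\<close> for
  \<open>1 \<le> i \<le> k\<close>.  As \<open>l > 1\<close>, the sizes \<open>l ^ i\<close> are distinct and the blocks nonempty, so a
  set of blocks loses no multiplicities.
\<close>

definition block_choice :: "nat \<Rightarrow> nat \<Rightarrow> (nat \<Rightarrow> nat) \<Rightarrow> 'n set set \<Rightarrow> bool" where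
  "block_choice l k b \<B> \<longleftrightarrow> disjoint \<B> \<and> (\<forall>X\<in>\<B>. \<exists>i\<in>{1..k}. card X = l ^ i) \<and>
     (\<forall>i\<in>{1..k}. card {X\<in>\<B>. card X = l ^ i} = b i)"

text \<open>
  The product of the full symmetric groups on the blocks: arbitrary permutations of each
  block, every basis vector outside the blocks being fixed.
\<close>

definition block_sym_product :: "'n set set \<Rightarrow> (complex ^ 'n \<Rightarrow> complex ^ 'n) set" where
  "block_sym_product \<B> = perm_map ` {\<pi>. \<pi> permutes \<Union>\<B> \<and> (\<forall>X\<in>\<B>. \<pi> ` X = X)}"

lemma block_choice_exists:
  assumes "l > 1" and "base_expression l CARD('n::finite) k b"
  shows "\<exists>\<B> :: 'n set set. block_choice l k b \<B>"
proof -
  define I where "I = (SIGMA i:{1..k}. {..<b i} \<times> {..<l ^ i})"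
  have fin: "finite I" by (auto simp: I_def)
  have "card I = (\<Sum>i=1..k. b i * l ^ i)" by (simp add: I_def card_cartesian_product)
  also have "\<dots> \<le> (\<Sum>i\<le>k. b i * l ^ i)" by (rule sum_mono2) auto
  finally have "card I \<le> CARD('n)" using assms(2) by (simp add: base_expression_def)
  then obtain f :: "nat \<times> nat \<times> nat \<Rightarrow> 'n" where f: "inj_on f I"
    using card_le_inj[OF fin, of "UNIV :: 'n set"] by auto
  define X where "X = (\<lambda>(i, j). f ` ({i} \<times> {j} \<times> {..<l ^ i}))"
  define J where "J = (SIGMA i:{1..k}. {..<b i})"
  have sub: "{i} \<times> {j} \<times> {..<l ^ i} \<subseteq> I" if "(i, j) \<in> J" for i j
    using that by (auto simp: I_def J_def)
  have cardX: "card (X (i, j)) = l ^ i" if "(i, j) \<in> J" for i j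
    using inj_on_subset[OF f sub[OF that]] by (simp add: X_def card_image card_cartesian_product)
  have dj: "X a \<inter> X c = {}" if a: "a \<in> J" and c: "c \<in> J" and ne: "a \<noteq> c" for a c
  proof -
    obtain i j i' j' where e: "a = (i, j)" "c = (i', j')" by (cases a, cases c)
    show ?thesis
      using inj_on_image_Int[OF f sub[of i j] sub[of i' j']] a c ne
      unfolding e X_def by (auto simp del: image_Int)
  qed
  have ne: "X a \<noteq> {}" if "a \<in> J" for a
    using \<open>l > 1\<close> by (cases a) (auto simp: X_def lessThan_empty_iff)
  have injX: "inj_on X J"
    using dj ne by (metis inf.idem inj_onI)
  have "disjoint (X ` J)"
    using dj by (auto simp: disjoint_def) (metis disjoint_iff)+
  moreover have "\<forall>Y\<in>X ` J. \<exists>i\<in>{1..k}. card Y = l ^ i"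
    using cardX by (fastforce simp: J_def)
  moreover have "card {Y \<in> X ` J. card Y = l ^ i} = b i" if "i \<in> {1..k}" for i
  proof -
    have "{Y \<in> X ` J. card Y = l ^ i} = X ` ({i} \<times> {..<b i})"
      using that cardX \<open>l > 1\<close> by (fastforce simp: J_def image_iff)
    moreover have "inj_on X ({i} \<times> {..<b i})"
      by (rule inj_on_subset[OF injX]) (use that in \<open>auto simp: J_def\<close>)
    ultimately show ?thesis by (simp add: card_image card_cartesian_product)
  qed
  ultimately show ?thesis unfolding block_choice_def by blast
qed

end

theory Submission
  imports Defs "HOL-Algebra.Group_Action" "HOL-Algebra.Sylow"
begin

text \<open>
  By Sylow conjugacy, if \<open>S\<close> is a Sylow subgroup contained in a parabolic subgroup \<open>P\<close> and every
  vector fixed by \<open>S\<close> is fixed by \<open>P\<close>, then the minimal parabolic subgroups containing a Sylow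
  subgroup are the conjugates of \<open>P\<close>.  If \<open>l\<close> divides \<open>m\<close>, every Sylow subgroup contains the
  \<open>l\<close>-torsion of the diagonal subgroup and so has no nonzero fixed vector, and \<open>P\<close> is the whole
  group.  Otherwise the order of the diagonal subgroup is prime to \<open>l\<close>, the product of symmetric
  groups on the blocks has the same \<open>l\<close>-part as \<open>n!\<close>, and its Sylow subgroups are transitive on
  each block; it is the pointwise stabiliser of the vectors that are constant on each block.
\<close>

section \<open>Sylow conjugacy\<close>

text \<open>Orbit sizes divide \<open>p ^ a\<close>, so an orbit that is not a single fixed point
  has size divisible by \<open>p\<close>. Without fixed points, \<open>p\<close> would divide the
  sum of the orbit sizes, which is \<open>card E\<close>.\<close>

lemma (in group_action) fixed_point_of_prime_power_order:
  assumes "prime p" and "order G = p ^ a" and "finite E" and "\<not> p dvd card E"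
  shows "\<exists>x\<in>E. \<forall>g\<in>carrier G. \<phi> g x = x"
proof (rule ccontr)
  assume none: "\<not> ?thesis"
  have G: "group G" using group_hom by (simp add: group_hom_def)
  have "p dvd card X" if X: "X \<in> orbits G E \<phi>" for X
  proof -
    from X obtain x where x: "x \<in> E" "X = orbit G \<phi> x" by (auto simp: orbits_def)
    have "card X dvd p ^ a"
      using orbit_stabilizer_theorem[OF x(1)] x(2) assms(2) by (metis dvd_triv_left)
    then obtain b where b: "card X = p ^ b" using divides_primepow_nat[OF assms(1)] by blast
    have "b \<noteq> 0"
    proof
      assume "b = 0"
      then obtain y where y: "X = {y}" using b card_1_singletonE by auto
      with x have "y = x" using orbit_refl[OF x(1)] by (metis singletonD)
      then have "\<forall>g\<in>carrier G. \<phi> g x = x" using x y by (auto simp: orbit_def)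
      with none x(1) show False by blast
    qed
    then show ?thesis using b by simp
  qed
  moreover have "pairwise disjnt (orbits G E \<phi>)"
    using disjoint_union by (auto simp: pairwise_def disjnt_def)
  moreover have "finite X" if "X \<in> orbits G E \<phi>" for X
    using that orbits_coverture assms(3) by (metis Union_upper finite_subset)
  ultimately have "p dvd card (\<Union> (orbits G E \<phi>))"
    by (subst card_Union_disjoint) (auto intro: dvd_sum)
  with assms(4) show False by (simp add: orbits_coverture)
qed

text \<open>\<open>T\<close> acts on the right cosets of \<open>S\<close>, whose number is prime to
  \<open>p\<close>, so some coset \<open>S #> x\<close> is fixed; this says that \<open>x\<close>
  conjugates \<open>T\<close> into \<open>S\<close>. It is applied both to a Sylow subgroup
  \<open>T\<close> and to the \<open>l\<close>-torsion of the diagonal subgroup.\<close>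

lemma (in group) prime_power_subgroup_conj_into:
  assumes fin: "finite (carrier G)" and p: "prime p"
    and S: "subgroup S G" "\<not> p dvd card (rcosets S)"
    and T: "subgroup T G" "card T = p ^ a"
  shows "\<exists>x\<in>carrier G. \<forall>t\<in>T. x \<otimes> t \<otimes> inv x \<in> S"
proof -
  interpret S: subgroup S G by fact
  interpret T: subgroup T G by fact
  let ?E = "rcosets S" and ?T = "G\<lparr>carrier := T\<rparr>"
  \<comment> \<open>The inverse turns right multiplication into a left action. The function is
    restricted to \<open>?E\<close> because elements of \<open>Bij ?E\<close> are
    extensional.\<close>
  define \<phi> where "\<phi> = (\<lambda>t. \<lambda>X\<in>?E. X #> inv t)"
  have sub: "X \<subseteq> carrier G" if "X \<in> ?E" for X
    using that S.subset rcosets_subset_PowG[OF S(1)] by blast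
  have act: "X #> inv t \<in> ?E" if X: "X \<in> ?E" and t: "t \<in> T" for X t
  proof -
    from X obtain x where x: "x \<in> carrier G" "X = S #> x" by (auto simp: RCOSETS_def)
    then have "X #> inv t = S #> (x \<otimes> inv t)"
      using t S.subset by (simp add: coset_mult_assoc)
    then show ?thesis using x t by (auto simp: RCOSETS_def)
  qed
  have comp: "(X #> inv t) #> inv s = X #> inv (s \<otimes> t)"
    if "X \<in> ?E" "s \<in> T" "t \<in> T" for X s t
    using that sub by (simp add: coset_mult_assoc inv_mult_group)
  have Bij: "\<phi> t \<in> Bij ?E" if t: "t \<in> T" for t
  proof -
    have "bij_betw (\<lambda>X. X #> inv t) ?E ?E"
    proof (rule bij_betwI[where g = "\<lambda>X. X #> inv (inv t)"])
      show "(\<lambda>X. X #> inv t) \<in> ?E \<rightarrow> ?E" using act t by auto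
      show "(\<lambda>X. X #> inv (inv t)) \<in> ?E \<rightarrow> ?E" using act[of _ "inv t"] t by auto
      show "X #> inv t #> inv (inv t) = X" if "X \<in> ?E" for X
        using that t comp[of X "inv t" t] sub by simp
      show "X #> inv (inv t) #> inv t = X" if "X \<in> ?E" for X
        using that t comp[of X t "inv t"] sub by simp
    qed
    then show ?thesis by (auto simp: Bij_def \<phi>_def cong: bij_betw_cong)
  qed
  have hom: "\<phi> (s \<otimes> t) = \<phi> s \<otimes>\<^bsub>BijGroup ?E\<^esub> \<phi> t" if "s \<in> T" "t \<in> T" for s t
  proof -
    have "\<phi> (s \<otimes> t) = compose ?E (\<phi> s) (\<phi> t)"
      using that act comp by (auto simp: \<phi>_def compose_def fun_eq_iff)
    then show ?thesis using that Bij by (simp add: BijGroup_def)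
  qed
  interpret group_action ?T ?E \<phi>
    using Bij hom T.subgroup_is_group[OF is_group] group_BijGroup
    by (auto simp: group_action_def group_hom_def group_hom_axioms_def hom_def BijGroup_def)
  have "finite ?E" using sub fin by (meson Pow_iff finite_Pow_iff finite_subset subsetI)
  then obtain X where X: "X \<in> ?E" "\<And>t. t \<in> T \<Longrightarrow> \<phi> t X = X"
    using fixed_point_of_prime_power_order[OF p _ _ S(2), of a] T(2) by (auto simp: order_def)
  from X(1) obtain x where x: "x \<in> carrier G" "X = S #> x" by (auto simp: RCOSETS_def)
  have "x \<otimes> t \<otimes> inv x \<in> S" if t: "t \<in> T" for t
  proof -
    have "X #> inv (inv t) = X" using X(2)[of "inv t"] X(1) t by (simp add: \<phi>_def)
    then have "S #> (x \<otimes> t) = S #> x" using x t S.subset by (simp add: coset_mult_assoc)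
    then have "x \<otimes> t \<in> S #> x" using x t rcos_self[of "x \<otimes> t" S] S(1) by auto
    then obtain s where "s \<in> S" "x \<otimes> t = s \<otimes> x" by (auto simp: r_coset_def)
    then show ?thesis using x(1) by (simp add: m_assoc)
  qed
  then show ?thesis using x(1) by blast
qed

text \<open>Translates the definition of Sylow subgroups by their order into the index condition of
  the fixed point argument: a further factor \<open>p\<close> in the index would exceed the
  multiplicity of \<open>p\<close> in the group order.\<close>

lemma (in group) sylow_subgroup_index:
  assumes "finite (carrier G)" and "prime p" and "sylow_subgroup p G S"
  shows "\<not> p dvd card (rcosets S)"
proof
  have S: "subgroup S G" "card S = p ^ multiplicity p (order G)"
    using assms(3) by (auto simp: sylow_subgroup_def)
  have L: "card (rcosets S) * card S = order G" by (rule lagrange[OF S(1)])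
  assume "p dvd card (rcosets S)"
  then have "p * p ^ multiplicity p (order G) dvd order G"
    using L S(2) by (metis dvd_refl mult_dvd_mono)
  moreover have "order G \<noteq> 0" using assms(1) order_gt_0_iff_finite by auto
  ultimately show False using assms(2)
    by (metis not_dvd_imp_multiplicity_0 power_Suc power_dvd_iff_le_multiplicity Suc_n_not_le_n
        not_prime_unit)
qed

lemma (in group) conj_image_subgroup:
  assumes "subgroup S G" and "x \<in> carrier G"
  shows "subgroup ((\<lambda>s. x \<otimes> s \<otimes> inv x) ` S) G"
proof -
  interpret S: subgroup S G by fact
  interpret c: group_hom G G "\<lambda>s. x \<otimes> s \<otimes> inv x"
    by unfold_locales (use assms(2) in \<open>auto simp: hom_def m_assoc inv_solve_left\<close>)
  show ?thesis by (rule c.subgroup_img_is_subgroup[OF assms(1)])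
qed

section \<open>Finite linear groups\<close>

lemma group_GL: "group (GL :: (complex ^ 'n \<Rightarrow> complex ^ 'n) monoid)"
proof (rule groupI)
  fix f :: "complex ^ 'n \<Rightarrow> complex ^ 'n"
  assume "f \<in> carrier GL"
  then have f: "Vector_Spaces.linear (*s) (*s) f" "bij f" by (auto simp: GL_def)
  then have "Vector_Spaces.linear (*s) (*s) (inv_into UNIV f)"
    by (auto simp: Vector_Spaces.linear_iff vec.vector_space_axioms bij_def surj_f_inv_f
          intro!: inv_f_eq)
  with f show "\<exists>g\<in>carrier GL. g \<otimes>\<^bsub>GL\<^esub> f = \<one>\<^bsub>GL\<^esub>"
    by (auto simp: GL_def bij_imp_bij_inv bij_is_inj intro!: bexI[of _ "inv_into UNIV f"])
qed (auto simp: GL_def Vector_Spaces.linear_compose vec.linear_id bij_comp o_assoc)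

lemma inv_GL:
  assumes "f \<in> carrier GL"
  shows "inv\<^bsub>GL\<^esub> f = inv_into UNIV f"
proof -
  interpret group "GL :: (complex ^ 'a \<Rightarrow> complex ^ 'a) monoid" by (rule group_GL)
  have f: "Vector_Spaces.linear (*s) (*s) f" "bij f" using assms by (auto simp: GL_def)
  have "f ((inv\<^bsub>GL\<^esub> f) v) = v" for v
    using r_inv[OF assms] by (simp add: GL_def fun_eq_iff)
  then show ?thesis using f(2) by (metis bij_is_inj inv_f_eq ext)
qed

lemma GL_action:
  fixes H :: "(complex ^ 'n \<Rightarrow> complex ^ 'n) set"
  assumes "subgroup H GL"
  shows "group_action (GL\<lparr>carrier := H\<rparr>) UNIV (\<lambda>g. g)"
proof -
  interpret group "GL :: (complex ^ 'n \<Rightarrow> complex ^ 'n) monoid" by (rule group_GL)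
  have "g \<in> Bij UNIV" if "g \<in> H" for g
    using subgroup.subset[OF assms] that by (auto simp: Bij_def GL_def)
  then show ?thesis using subgroup_imp_group[OF assms]
    by (auto simp: group_action_def group_hom_def group_hom_axioms_def hom_def BijGroup_def compose_def GL_def
          fun_eq_iff group_BijGroup[unfolded BijGroup_def compose_def])
qed

text \<open>Serves to compare the orbits of a basis vector under the block group and under a Sylow
  subgroup of it.\<close>

lemma orbit_stabilizer_GL:
  fixes H :: "(complex ^ 'n \<Rightarrow> complex ^ 'n) set"
  assumes "subgroup H GL"
  shows "card ((\<lambda>g. g v) ` H) * card {g \<in> H. g v = v} = card H"
proof -
  interpret group_action "GL\<lparr>carrier := H\<rparr>" UNIV "\<lambda>g. g" by (rule GL_action[OF assms])
  have "orbit (GL\<lparr>carrier := H\<rparr>) (\<lambda>g. g) v = (\<lambda>g. g v) ` H" by (auto simp: orbit_def)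
  then show ?thesis using orbit_stabilizer_theorem[of v] by (simp add: stabilizer_def order_def)
qed

lemma stabilizer_subgroup_GL:
  fixes H :: "(complex ^ 'n \<Rightarrow> complex ^ 'n) set"
  assumes H: "subgroup H GL"
  shows "subgroup {g \<in> H. \<forall>u\<in>U. g u = u} GL"
proof -
  interpret group "GL :: (complex ^ 'n \<Rightarrow> complex ^ 'n) monoid" by (rule group_GL)
  interpret H: subgroup H GL by fact
  show ?thesis
  proof (rule subgroupI)
    have "id \<in> H" using H.one_closed by (simp add: GL_def)
    then have "id \<in> {g \<in> H. \<forall>u\<in>U. g u = u}" by simp
    then show "{g \<in> H. \<forall>u\<in>U. g u = u} \<noteq> {}" by blast
    show "inv\<^bsub>GL\<^esub> g \<in> {g \<in> H. \<forall>u\<in>U. g u = u}" if "g \<in> {g \<in> H. \<forall>u\<in>U. g u = u}" for g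
    proof -
      have g: "g \<in> H" "\<forall>u\<in>U. g u = u" "g \<in> carrier GL" using that H.subset by auto
      then have "inv_into UNIV g u = u" if "u \<in> U" for u
        using that by (auto simp: GL_def bij_def intro!: inv_f_eq)
      then show ?thesis using g H.m_inv_closed[OF g(1)] by (simp add: inv_GL[OF g(3)])
    qed
  qed (use H.subset H.m_closed in \<open>auto simp: GL_def\<close>)
qed

section \<open>Conjugation and minimal parabolic subgroups in a finite linear group\<close>

definition conj_set :: "('a \<Rightarrow> 'a) \<Rightarrow> ('a \<Rightarrow> 'a) set \<Rightarrow> ('a \<Rightarrow> 'a) set" where
  "conj_set h P = (\<lambda>g. h \<circ> g \<circ> inv_into UNIV h) ` P"

text \<open>Keeping the set \<open>H\<close> apart from the record \<open>G\<close> allows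
  simplification rules that replace the group operations by composition and inverse
  functions.\<close>

locale finite_linear_group =
  fixes H :: "(complex ^ 'n \<Rightarrow> complex ^ 'n) set"
    and G :: "(complex ^ 'n \<Rightarrow> complex ^ 'n) monoid"
  assumes H: "subgroup H GL" and fin: "finite H" and G: "G = GL\<lparr>carrier := H\<rparr>"
begin

sublocale H: subgroup H GL by (rule H)

sublocale group G
  unfolding G by (rule H.subgroup_is_group[OF group_GL])

lemma carrier [simp]: "carrier G = H"
  and mult [simp]: "f \<otimes>\<^bsub>G\<^esub> g = f \<circ> g"
  and one [simp]: "\<one>\<^bsub>G\<^esub> = id"
  by (simp_all add: G GL_def)

lemma m_inv_eq [simp]:
  assumes "h \<in> H" shows "inv\<^bsub>G\<^esub> h = inv_into UNIV h"
  using assms H.subset inv_GL group.m_inv_consistent[OF group_GL H assms] by (auto simp: G)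

lemma bij: "h \<in> H \<Longrightarrow> bij h"
  using H.subset by (auto simp: GL_def)

lemma inv_apply [simp]:
  assumes "h \<in> H" shows "inv_into UNIV h (h v) = v" and "h (inv_into UNIV h v) = v"
  using bij[OF assms] by (simp_all add: bij_is_inj bij_is_surj surj_f_inv_f)

lemma inv_mem: "h \<in> H \<Longrightarrow> inv_into UNIV h \<in> H"
  using inv_closed[of h] by simp

lemma linear: "h \<in> H \<Longrightarrow> Vector_Spaces.linear (*s) (*s) h"
  using H.subset by (auto simp: GL_def)

lemma conjugates_eq:
  assumes "P \<subseteq> H"
  shows "conjugates G P = {conj_set h P | h. h \<in> H}"
proof -
  have "(h <#\<^bsub>G\<^esub> P) #>\<^bsub>G\<^esub> (inv\<^bsub>G\<^esub> h) = conj_set h P" if "h \<in> H" for h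
    using that by (auto simp: conj_set_def l_coset_def r_coset_def)
  then show ?thesis unfolding conjugates_def by (simp add: Setcompr_eq_image)
qed

lemma parabolic_imp_subgroup:
  assumes "parabolic_subgroup G P"
  shows "subgroup P GL" and "subgroup P G" and "P \<subseteq> H"
proof -
  obtain U where U: "P = {g \<in> H. \<forall>u\<in>U. g u = u}"
    using assms by (auto simp: parabolic_subgroup_def)
  show "subgroup P GL" unfolding U by (rule stabilizer_subgroup_GL[OF H])
  then show "subgroup P G"
    unfolding G using group.subgroup_incl[OF group_GL _ H] U by blast
  show "P \<subseteq> H" using U by blast
qed

lemma parabolic_conj_set:
  assumes "parabolic_subgroup G P" and h: "h \<in> H"
  shows "parabolic_subgroup G (conj_set h P)"
proof -
  obtain U where U: "vec.subspace U" "P = {g \<in> H. \<forall>u\<in>U. g u = u}"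
    using assms by (auto simp: parabolic_subgroup_def)
  have "conj_set h P = {g \<in> H. \<forall>u\<in>h ` U. g u = u}"
  proof (intro equalityI subsetI)
    fix g assume "g \<in> conj_set h P"
    then obtain f where f: "f \<in> P" "g = h \<circ> f \<circ> inv_into UNIV h" by (auto simp: conj_set_def)
    then have "g \<in> H" using U h inv_mem m_closed by simp
    then show "g \<in> {g \<in> H. \<forall>u\<in>h ` U. g u = u}" using f U h by simp
  next
    fix g assume g: "g \<in> {g \<in> H. \<forall>u\<in>h ` U. g u = u}"
    define f where "f = inv_into UNIV h \<circ> g \<circ> h"
    have "f \<in> H" using g h inv_mem m_closed by (simp add: f_def)
    then have "f \<in> P" using g h U by (simp add: f_def)
    moreover have "g = h \<circ> f \<circ> inv_into UNIV h" using h by (simp add: f_def fun_eq_iff)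
    ultimately show "g \<in> conj_set h P" by (auto simp: conj_set_def)
  qed
  moreover have "vec.subspace (h ` U)" by (rule vec.linear_subspace_image[OF linear[OF h] U(1)])
  ultimately show ?thesis unfolding parabolic_subgroup_def by auto
qed

lemma card_conj_set:
  assumes "h \<in> H" shows "card (conj_set h P) = card P"
proof -
  have "inj_on (\<lambda>g. h \<circ> g \<circ> inv_into UNIV h) P"
  proof (rule inj_onI, rule ext)
    fix f g v assume "h \<circ> f \<circ> inv_into UNIV h = h \<circ> g \<circ> inv_into UNIV h"
    then have "h (f (inv_into UNIV h (h v))) = h (g (inv_into UNIV h (h v)))"
      by (metis comp_apply)
    then show "f v = g v" using assms by (metis inv_apply(1))
  qed
  then show ?thesis by (simp add: conj_set_def card_image)
qed

lemma sylow_conj_set: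
  assumes S: "sylow_subgroup l G S" and h: "h \<in> H"
  shows "sylow_subgroup l G (conj_set h S)"
proof -
  have S': "subgroup S G" using S by (simp add: sylow_subgroup_def)
  have "conj_set h S = (\<lambda>s. h \<otimes>\<^bsub>G\<^esub> s \<otimes>\<^bsub>G\<^esub> inv\<^bsub>G\<^esub> h) ` S"
    using h by (simp add: conj_set_def)
  then have "subgroup (conj_set h S) G" using conj_image_subgroup[OF S', of h] h by simp
  then show ?thesis using S card_conj_set[OF h] by (simp add: sylow_subgroup_def)
qed

text \<open>Sylow conjugacy gives \<open>h\<close> that conjugates \<open>S\<close> into a Sylow
  subgroup inside \<open>Q\<close>. If \<open>Q\<close> is the stabiliser of \<open>W\<close>, the
  inverse of \<open>h\<close> sends \<open>W\<close> to vectors fixed by \<open>S\<close>, hence by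
  \<open>P\<close>; so the conjugate of \<open>P\<close> fixes \<open>W\<close>.\<close>

lemma conj_set_subset_parabolic:
  assumes l: "prime l" and S: "sylow_subgroup l G S"
    and inv_P: "\<And>v. (\<forall>g\<in>S. g v = v) \<Longrightarrow> (\<forall>g\<in>P. g v = v)" and P: "P \<subseteq> H"
    and Q: "parabolic_subgroup G Q" "contains_sylow l G Q"
  shows "\<exists>h\<in>H. conj_set h P \<subseteq> Q"
proof -
  obtain W where W: "Q = {g \<in> H. \<forall>u\<in>W. g u = u}"
    using Q(1) by (auto simp: parabolic_subgroup_def)
  obtain T where T: "sylow_subgroup l G T" "T \<subseteq> Q"
    using Q(2) by (auto simp: contains_sylow_def)
  have "\<not> l dvd card (rcosets\<^bsub>G\<^esub> T)"
    by (rule sylow_subgroup_index[OF _ l T(1)]) (simp add: fin)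
  then obtain h where h: "h \<in> H" "\<And>s. s \<in> S \<Longrightarrow> h \<circ> s \<circ> inv_into UNIV h \<in> T"
    using prime_power_subgroup_conj_into[of l T S "multiplicity l (order G)"] fin l S T(1)
    by (auto simp: sylow_subgroup_def)
  have "conj_set h P \<subseteq> Q"
  proof
    fix g assume "g \<in> conj_set h P"
    then obtain f where f: "f \<in> P" "g = h \<circ> f \<circ> inv_into UNIV h" by (auto simp: conj_set_def)
    then have "g \<in> H" using P h(1) inv_mem m_closed by auto
    moreover have "g w = w" if w: "w \<in> W" for w
    proof -
      have "s (inv_into UNIV h w) = inv_into UNIV h w" if s: "s \<in> S" for s
      proof -
        have "h (s (inv_into UNIV h w)) = w"
          using h(2)[OF s] T(2) W w by auto
        then show ?thesis using h(1) by (metis inv_apply(1))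
      qed
      then have "f (inv_into UNIV h w) = inv_into UNIV h w" using inv_P f(1) by blast
      then show ?thesis using f(2) h(1) by simp
    qed
    ultimately show "g \<in> Q" using W by blast
  qed
  then show ?thesis using h(1) by blast
qed

text \<open>Every parabolic subgroup containing a Sylow subgroup contains a conjugate of
  \<open>P\<close>, and these conjugates are themselves such subgroups. Hence a minimal one is a
  conjugate, and finiteness makes every conjugate minimal.\<close>

lemma sylow_parabolic_class_eq_conjugates:
  assumes l: "prime l" and P: "parabolic_subgroup G P"
    and S: "sylow_subgroup l G S" "S \<subseteq> P"
    and inv_P: "\<And>v. (\<forall>g\<in>S. g v = v) \<Longrightarrow> (\<forall>g\<in>P. g v = v)"
  shows "sylow_parabolic_class l G = conjugates G P"
proof -
  have PH: "P \<subseteq> H" by (rule parabolic_imp_subgroup(3)[OF P])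
  have con: "contains_sylow l G (conj_set h P)" if "h \<in> H" for h
  proof -
    have "conj_set h S \<subseteq> conj_set h P" unfolding conj_set_def by (rule image_mono[OF S(2)])
    with sylow_conj_set[OF S(1) that] show ?thesis by (auto simp: contains_sylow_def)
  qed
  note below = conj_set_subset_parabolic[OF l S(1) inv_P PH]
  have "sylow_parabolic_class l G = {conj_set h P | h. h \<in> H}"
  proof (intro equalityI subsetI)
    fix Q assume "Q \<in> sylow_parabolic_class l G"
    then have Q: "parabolic_subgroup G Q" "contains_sylow l G Q"
      and min: "\<And>R. parabolic_subgroup G R \<Longrightarrow> contains_sylow l G R \<Longrightarrow> R \<subseteq> Q \<Longrightarrow> R = Q"
      by (auto simp: sylow_parabolic_class_def)
    obtain h where h: "h \<in> H" "conj_set h P \<subseteq> Q" using below Q by blast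
    then have "conj_set h P = Q" using min parabolic_conj_set[OF P] con by blast
    then show "Q \<in> {conj_set h P | h. h \<in> H}" using h(1) by blast
  next
    fix R assume "R \<in> {conj_set h P | h. h \<in> H}"
    then obtain h where h: "h \<in> H" "R = conj_set h P" by blast
    have R: "parabolic_subgroup G R" using parabolic_conj_set[OF P h(1)] h(2) by simp
    have "Q = R" if Q: "parabolic_subgroup G Q" "contains_sylow l G Q" "Q \<subseteq> R" for Q
    proof -
      obtain h' where h': "h' \<in> H" "conj_set h' P \<subseteq> Q" using below Q by blast
      \<comment> \<open>Both are conjugates of \<open>P\<close>, so they have the same finite
        cardinality and the inclusion through \<open>Q\<close> is an equality.\<close>
      then have "conj_set h' P = R"
        using Q(3) card_subset_eq[of R "conj_set h' P"] card_conj_set h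
          finite_subset[OF parabolic_imp_subgroup(3)[OF R] fin] by auto
      then show ?thesis using h'(2) Q(3) by blast
    qed
    then show "R \<in> sylow_parabolic_class l G"
      using R con h by (auto simp: sylow_parabolic_class_def)
  qed
  then show ?thesis by (simp add: conjugates_eq[OF PH])
qed

end

section \<open>Monomial transformations\<close>

lemma diag_map_nth [simp]: "diag_map \<theta> v $ j = \<theta> j * v $ j"
  by (simp add: diag_map_def basis_ext_def axis_def if_distrib cong: if_cong)

text \<open>The inverse appears because basis vectors move forward: coordinate \<open>j\<close> of
  the image comes from the index that \<open>\<pi>\<close> sends to \<open>j\<close>.\<close>

lemma perm_map_nth:
  assumes "bij \<pi>"
  shows "perm_map \<pi> v $ j = v $ inv_into UNIV \<pi> j"
proof -
  have "j = \<pi> i \<longleftrightarrow> i = inv_into UNIV \<pi> j" for i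
    using assms by (metis bij_is_inj bij_is_surj inv_f_f surj_f_inv_f)
  then show ?thesis
    by (simp add: perm_map_def basis_ext_def axis_def if_distrib cong: if_cong)
qed

lemma perm_map_axis: "perm_map \<pi> (axis i 1) = axis (\<pi> i) 1"
  by (simp add: perm_map_def)

lemma inj_on_perm_map: "inj_on perm_map A"
proof (rule inj_onI, rule ext)
  fix \<pi> \<sigma> :: "'a \<Rightarrow> 'a" and i assume "perm_map \<pi> = perm_map \<sigma>"
  then have "axis (\<pi> i) (1::complex) = axis (\<sigma> i) 1" by (metis perm_map_axis)
  then show "\<pi> i = \<sigma> i" by (simp add: axis_eq_axis)
qed

text \<open>The diagonal factor stands on the left, as in the product of \<open>A_group\<close> and
  \<open>Sym_group\<close>, so scalars are indexed by the target of the permutation.\<close>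

definition monomial_map :: "('n \<Rightarrow> complex) \<Rightarrow> ('n \<Rightarrow> 'n) \<Rightarrow> complex ^ 'n \<Rightarrow> complex ^ 'n" where
  "monomial_map \<theta> \<pi> = diag_map \<theta> \<circ> perm_map \<pi>"

lemma monomial_map_nth:
  "bij \<pi> \<Longrightarrow> monomial_map \<theta> \<pi> v $ j = \<theta> j * v $ inv_into UNIV \<pi> j"
  by (simp add: monomial_map_def perm_map_nth)

text \<open>Moving the second diagonal factor leftwards past the first permutation relabels its
  entries by the inverse permutation.\<close>

lemma monomial_map_comp:
  assumes "bij \<pi>" "bij \<sigma>"
  shows "monomial_map \<theta> \<pi> \<circ> monomial_map \<eta> \<sigma> =
    monomial_map (\<lambda>j. \<theta> j * \<eta> (inv_into UNIV \<pi> j)) (\<pi> \<circ> \<sigma>)"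
  using assms by (simp add: fun_eq_iff vec_eq_iff monomial_map_nth bij_comp o_inv_distrib)

lemma perm_map_eq_monomial_map: "perm_map \<pi> = monomial_map (\<lambda>_. 1) \<pi>"
  and diag_map_eq_monomial_map: "diag_map \<theta> = monomial_map \<theta> id"
  by (simp_all add: fun_eq_iff vec_eq_iff monomial_map_def perm_map_nth)

lemma monomial_map_axis: "monomial_map \<theta> \<pi> (axis i 1) = \<theta> (\<pi> i) *s axis (\<pi> i) 1"
  by (auto simp: monomial_map_def perm_map_axis vec_eq_iff) (auto simp: axis_def)

text \<open>The image of \<open>axis i 1\<close> has its only nonzero coordinate at
  \<open>\<pi> i\<close>, with value \<open>\<theta> (\<pi> i)\<close>. This determines the
  permutation and, as \<open>\<pi>\<close> is onto, all scalars.\<close>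

lemma monomial_map_inject:
  assumes "\<And>i. \<theta> i \<noteq> 0" and "monomial_map \<theta> \<pi> = monomial_map \<eta> \<sigma>" and "bij \<pi>"
  shows "\<theta> = \<eta>" and "\<pi> = \<sigma>"
proof -
  have ax: "\<theta> (\<pi> i) *s axis (\<pi> i) 1 = \<eta> (\<sigma> i) *s axis (\<sigma> i) 1" for i
    using assms(2) by (metis monomial_map_axis)
  have *: "\<pi> i = \<sigma> i \<and> \<theta> (\<pi> i) = \<eta> (\<pi> i)" for i
    using arg_cong[OF ax[of i], of "\<lambda>v. v $ \<pi> i"] assms(1)[of "\<pi> i"]
    by (auto simp: axis_def split: if_splits)
  then show "\<pi> = \<sigma>" by blast
  show "\<theta> = \<eta>"
  proof
    fix j
    obtain i where "j = \<pi> i" using assms(3) by (metis bij_is_surj surjD)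
    with *[of i] show "\<theta> j = \<eta> j" by metis
  qed
qed

text \<open>Two independent exponents cover several groups: \<open>r = m\<close> and
  \<open>q = m div p\<close> give the entries of \<open>A(m,p,n)\<close>; for a prime
  \<open>l\<close> dividing \<open>m\<close>, \<open>r = l\<close> with the same \<open>q\<close>
  gives its \<open>l\<close>-torsion; \<open>q = 0\<close> gives all functions into the
  \<open>r\<close>-th roots of unity.\<close>

definition root_functions :: "nat \<Rightarrow> nat \<Rightarrow> ('n::finite \<Rightarrow> complex) set" where
  "root_functions r q = {\<theta>. (\<forall>i. \<theta> i ^ r = 1) \<and> (\<Prod>i\<in>UNIV. \<theta> i ^ q) = 1}"

lemma root_functions_nonzero: "\<theta> i \<noteq> 0" if "\<theta> \<in> root_functions r q" "r > 0"
  using that by (metis (mono_tags, lifting) mem_Collect_eq power_0_left root_functions_def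
      not_gr_zero zero_neq_one)

lemma root_functions_mult:
  "\<theta> \<in> root_functions r q \<Longrightarrow> \<eta> \<in> root_functions r q \<Longrightarrow> (\<lambda>i. \<theta> i * \<eta> i) \<in> root_functions r q"
  by (simp add: root_functions_def power_mult_distrib prod.distrib)

lemma root_functions_inverse:
  "\<theta> \<in> root_functions r q \<Longrightarrow> (\<lambda>i. inverse (\<theta> i)) \<in> root_functions r q"
  using prod_inversef[of "\<lambda>i. \<theta> i ^ q" UNIV]
  by (simp add: root_functions_def power_inverse comp_def)

lemma root_functions_one: "(\<lambda>_. 1) \<in> root_functions r q"
  by (simp add: root_functions_def)

lemma root_functions_permute:
  assumes "\<theta> \<in> root_functions r q" and "bij \<pi>"
  shows "(\<lambda>i. \<theta> (\<pi> i)) \<in> root_functions r q"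
  using assms prod.reindex_bij_betw[OF assms(2), of "\<lambda>i. \<theta> i ^ q"]
  by (simp add: root_functions_def)

text \<open>For \<open>q = 0\<close> the product condition reads \<open>1 = 1\<close>, which leaves
  a full function space; for other \<open>q\<close> the set lies inside this one.\<close>

lemma card_root_functions:
  assumes "r > 0"
  shows "card (root_functions r 0 :: ('n::finite \<Rightarrow> complex) set) = r ^ CARD('n)"
    and "finite (root_functions r q :: ('n \<Rightarrow> complex) set)"
proof -
  have eq: "root_functions r 0 = (\<Pi>\<^sub>E i\<in>(UNIV :: 'n set). {z::complex. z ^ r = 1})"
    by (auto simp: root_functions_def PiE_UNIV_domain)
  have "card (root_functions r 0 :: ('n::finite \<Rightarrow> complex) set) =
      card {z::complex. z ^ r = 1} ^ CARD('n)"
    unfolding eq by (simp add: card_PiE)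
  then show "card (root_functions r 0 :: ('n::finite \<Rightarrow> complex) set) = r ^ CARD('n)"
    using assms by (simp add: card_roots_unity_eq)
  moreover have "root_functions r q \<subseteq> (root_functions r 0 :: ('n \<Rightarrow> complex) set)"
    by (auto simp: root_functions_def)
  ultimately show "finite (root_functions r q :: ('n \<Rightarrow> complex) set)"
    using assms by (metis card_ge_0_finite finite_subset zero_less_power)
qed

text \<open>Lagrange's theorem in the pointwise multiplicative group of all functions into the
  \<open>r\<close>-th roots of unity. The divisibility shows that the order is prime to
  \<open>l\<close> when \<open>l\<close> does not divide \<open>r\<close>, and a power of
  \<open>l\<close> when \<open>r = l\<close>.\<close>

lemma card_root_functions_dvd:
  assumes r: "r > 0"
  shows "card (root_functions r q :: ('n::finite \<Rightarrow> complex) set) dvd r ^ CARD('n)"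
proof -
  define D :: "('n \<Rightarrow> complex) monoid" where
    "D = \<lparr>carrier = root_functions r 0, mult = (\<lambda>\<theta> \<eta> i. \<theta> i * \<eta> i), one = (\<lambda>_. 1)\<rparr>"
  have nz: "\<theta> i \<noteq> 0" if "\<theta> \<in> root_functions r q" for \<theta> i q
    using root_functions_nonzero that r by blast
  interpret D: group D
  proof (rule groupI)
    fix \<theta> assume \<theta>: "\<theta> \<in> carrier D"
    then show "\<exists>\<eta>\<in>carrier D. \<eta> \<otimes>\<^bsub>D\<^esub> \<theta> = \<one>\<^bsub>D\<^esub>"
      using root_functions_inverse nz[of \<theta> 0]
      by (auto simp: D_def intro!: bexI[of _ "\<lambda>i. inverse (\<theta> i)"])
  qed (auto simp: D_def root_functions_mult root_functions_one algebra_simps)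
  have sub: "root_functions r q \<subseteq> carrier D" by (auto simp: D_def root_functions_def)
  have "subgroup (root_functions r q) D"
  proof (rule D.subgroupI[OF sub])
    show "root_functions r q \<noteq> {}" using root_functions_one by blast
    show "inv\<^bsub>D\<^esub> \<theta> \<in> root_functions r q" if \<theta>: "\<theta> \<in> root_functions r q" for \<theta>
    proof -
      have "inv\<^bsub>D\<^esub> \<theta> = (\<lambda>i. inverse (\<theta> i))"
        by (rule D.inv_equality)
          (use \<theta> sub root_functions_inverse[OF \<theta>] nz[OF \<theta>] in \<open>auto simp: D_def\<close>)
      then show ?thesis using root_functions_inverse[OF \<theta>] by simp
    qed
  qed (auto simp: D_def root_functions_mult)
  then have "card (rcosets\<^bsub>D\<^esub> root_functions r q) * card (root_functions r q :: ('n \<Rightarrow> complex) set) =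
      order D"
    by (rule D.lagrange)
  moreover have "order D = r ^ CARD('n)" by (simp add: order_def D_def card_root_functions(1)[OF r])
  ultimately show ?thesis by (metis dvd_triv_right)
qed

section \<open>The group \<open>G(m,p,n)\<close> as a set of monomial maps\<close>

definition monomial_set :: "nat \<Rightarrow> nat \<Rightarrow> (complex ^ 'n \<Rightarrow> complex ^ 'n) set" where
  "monomial_set r q = {monomial_map \<theta> \<pi> | \<theta> \<pi>. \<theta> \<in> root_functions r q \<and> bij \<pi>}"

lemma imprim_group_eq: "imprim_group m p = GL\<lparr>carrier := monomial_set m (m div p)\<rparr>"
proof -
  have "A_group m p <#>\<^bsub>GL\<^esub> Sym_group =
      (monomial_set m (m div p) :: (complex ^ 'a \<Rightarrow> complex ^ 'a) set)"
    by (auto simp: set_mult_def A_group_def Sym_group_def monomial_set_def root_functions_def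
        monomial_map_def GL_def permutes_univ bij_iff)
  then show ?thesis by (simp add: imprim_group_def)
qed

lemma monomial_set_subgroup:
  assumes r: "r > 0"
  shows "subgroup (monomial_set r q) (GL :: (complex ^ 'n \<Rightarrow> complex ^ 'n) monoid)"
proof -
  interpret GL: group "GL :: (complex ^ 'n \<Rightarrow> complex ^ 'n) monoid" by (rule group_GL)
  have left_inv: "\<exists>g\<in>monomial_set r q. g \<circ> f = id \<and> f \<circ> g = id"
    if "f \<in> monomial_set r q" for f :: "complex ^ 'n \<Rightarrow> complex ^ 'n"
  proof -
    from that obtain \<theta> \<pi> where f: "f = monomial_map \<theta> \<pi>" "\<theta> \<in> root_functions r q" "bij \<pi>"
      by (auto simp: monomial_set_def)
    \<comment> \<open>The inverse scales back first and permutes afterwards; with the diagonal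
      factor brought to the left, its entries are the inverses relabelled by
      \<open>\<pi>\<close>.\<close>
    define g where "g = monomial_map (\<lambda>i. inverse (\<theta> (\<pi> i))) (inv_into UNIV \<pi>)"
    have nz: "\<theta> i \<noteq> 0" for i using root_functions_nonzero f(2) r by blast
    have "g \<in> monomial_set r q"
      using root_functions_permute[OF root_functions_inverse[OF f(2)] f(3)] bij_imp_bij_inv[OF f(3)]
      by (auto simp: g_def monomial_set_def)
    moreover have "g \<circ> f = id \<and> f \<circ> g = id"
      using f(3) nz bij_imp_bij_inv[OF f(3)]
      by (auto simp: f(1) g_def fun_eq_iff vec_eq_iff monomial_map_nth inv_inv_eq bij_is_inj
          bij_is_surj surj_f_inv_f)
    ultimately show ?thesis by blast
  qed
  have sub: "monomial_set r q \<subseteq> carrier (GL :: (complex ^ 'n \<Rightarrow> complex ^ 'n) monoid)"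
  proof
    fix f :: "complex ^ 'n \<Rightarrow> complex ^ 'n" assume f: "f \<in> monomial_set r q"
    then have "Vector_Spaces.linear (*s) (*s) f"
      by (auto simp: monomial_set_def monomial_map_def diag_map_def perm_map_def
          intro!: Vector_Spaces.linear_compose linear_basis_ext)
    moreover have "bij f" using left_inv[OF f] o_bij by blast
    ultimately show "f \<in> carrier GL" by (simp add: GL_def)
  qed
  show ?thesis
  proof (rule GL.subgroupI[OF sub])
    have "monomial_map (\<lambda>_. 1) id \<in> monomial_set r q"
      unfolding monomial_set_def using root_functions_one bij_id by blast
    then show "monomial_set r q \<noteq> ({} :: (complex ^ 'n \<Rightarrow> complex ^ 'n) set)" by blast
  next
    fix f :: "complex ^ 'n \<Rightarrow> complex ^ 'n" assume f: "f \<in> monomial_set r q"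
    then obtain g where g: "g \<in> monomial_set r q" "g \<circ> f = id" using left_inv by blast
    then have "inv\<^bsub>GL\<^esub> f = g" using f sub by (intro GL.inv_equality) (auto simp: GL_def)
    then show "inv\<^bsub>GL\<^esub> f \<in> monomial_set r q" using g(1) by simp
  next
    fix f g :: "complex ^ 'n \<Rightarrow> complex ^ 'n"
    assume "f \<in> monomial_set r q" "g \<in> monomial_set r q"
    then obtain \<theta> \<pi> \<eta> \<sigma> where "f = monomial_map \<theta> \<pi>" "\<theta> \<in> root_functions r q" "bij \<pi>"
      "g = monomial_map \<eta> \<sigma>" "\<eta> \<in> root_functions r q" "bij \<sigma>"
      by (auto simp: monomial_set_def)
    then show "f \<otimes>\<^bsub>GL\<^esub> g \<in> monomial_set r q"
      using root_functions_mult[OF _ root_functions_permute[OF _ bij_imp_bij_inv]]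
      by (auto simp: GL_def monomial_set_def monomial_map_comp intro!: bij_comp exI)
  qed
qed

lemma card_monomial_set:
  assumes r: "r > 0"
  shows "card (monomial_set r q :: (complex ^ 'n \<Rightarrow> complex ^ 'n) set) =
      card (root_functions r q :: ('n \<Rightarrow> complex) set) * fact CARD('n)"
    and "finite (monomial_set r q :: (complex ^ 'n \<Rightarrow> complex ^ 'n) set)"
proof -
  let ?D = "root_functions r q \<times> {\<pi> :: 'n \<Rightarrow> 'n. bij \<pi>}"
  have eq: "monomial_set r q = (\<lambda>(\<theta>, \<pi>). monomial_map \<theta> \<pi>) ` ?D"
    by (auto simp: monomial_set_def)
  have inj: "inj_on (\<lambda>(\<theta>, \<pi>). monomial_map \<theta> \<pi>) ?D"
  proof (rule inj_onI, clarify, rule conjI)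
    fix \<theta> \<eta> :: "'n \<Rightarrow> complex" and \<pi> \<sigma> :: "'n \<Rightarrow> 'n"
    assume *: "\<theta> \<in> root_functions r q" "bij \<pi>" "monomial_map \<theta> \<pi> = monomial_map \<eta> \<sigma>"
    have "\<theta> i \<noteq> 0" for i by (rule root_functions_nonzero[OF *(1) r])
    from monomial_map_inject[OF this *(3,2)] show "\<theta> = \<eta>" and "\<pi> = \<sigma>" by simp_all
  qed
  have perms: "{\<pi> :: 'n \<Rightarrow> 'n. bij \<pi>} = {\<pi>. \<pi> permutes UNIV}"
    by (auto simp: permutes_univ bij_iff)
  show "finite (monomial_set r q :: (complex ^ 'n \<Rightarrow> complex ^ 'n) set)"
    unfolding eq perms using card_root_functions(2)[OF r]
    by (intro finite_imageI finite_cartesian_product finite_permutations) auto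
  show "card (monomial_set r q :: (complex ^ 'n \<Rightarrow> complex ^ 'n) set) =
      card (root_functions r q :: ('n \<Rightarrow> complex) set) * fact CARD('n)"
    by (simp only: eq card_image[OF inj])
      (simp add: perms card_cartesian_product card_permutations)
qed

lemma finite_linear_group_monomial_set:
  "r > 0 \<Longrightarrow> finite_linear_group (monomial_set r q) (GL\<lparr>carrier := monomial_set r q\<rparr>)"
  by (simp add: finite_linear_group_def monomial_set_subgroup card_monomial_set)

lemma perm_map_in_monomial_set: "bij \<pi> \<Longrightarrow> perm_map \<pi> \<in> monomial_set r q"
  unfolding perm_map_eq_monomial_map monomial_set_def using root_functions_one by blast

section \<open>Permutations preserving blocks\<close>

text \<open>One step of Legendre's formula. The factors after \<open>l * a\<close> up to
  \<open>l * a + r\<close> are prime to \<open>l\<close>, and passing from \<open>l * a\<close> to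
  \<open>l * Suc a\<close> adds only one factor divisible by \<open>l\<close>.\<close>

lemma multiplicity_fact_mult_add:
  fixes l :: nat
  assumes l: "prime l" and "r < l"
  shows "multiplicity l (fact (l * a + r) :: nat) = a + multiplicity l (fact a :: nat)"
proof -
  have step: "multiplicity l (fact (l * a + r) :: nat) = a + multiplicity l (fact a :: nat)"
    if "multiplicity l (fact (l * a) :: nat) = a + multiplicity l (fact a :: nat)" "r < l" for a r
    using that(2)
  proof (induction r)
    case 0
    then show ?case using that(1) by simp
  next
    case (Suc r)
    have "\<not> l dvd Suc r" using Suc.prems by (auto dest: dvd_imp_le)
    then have "\<not> l dvd Suc (l * a + r)"
      using dvd_add_right_iff[of l "l * a" "Suc r"] by simp
    then have "multiplicity l (Suc (l * a + r)) = 0" by (rule not_dvd_imp_multiplicity_0)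
    moreover have "fact (l * a + Suc r) = Suc (l * a + r) * (fact (l * a + r) :: nat)" by simp
    ultimately show ?case
      using Suc prime_elem_multiplicity_mult_distrib[of l "Suc (l * a + r)" "fact (l * a + r)"] l
      by simp
  qed
  have "multiplicity l (fact (l * a) :: nat) = a + multiplicity l (fact a :: nat)" for a
  proof (induction a)
    case 0
    then show ?case by simp
  next
    case (Suc a)
    have l0: "l > 0" using l prime_gt_0_nat by blast
    \<comment> \<open>Only the last factor is split off; what remains has remainder
      \<open>l - 1\<close>, the largest one that \<open>step\<close> admits.\<close>
    have "fact (l * Suc a) = l * Suc a * (fact (l * a + (l - 1)) :: nat)"
      using l0 fact_Suc[of "l * a + (l - 1)", where 'a = nat] by (simp add: algebra_simps)
    moreover have "multiplicity l (fact (l * a + (l - 1)) :: nat) = a + multiplicity l (fact a :: nat)"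
      using step[OF Suc, of "l - 1"] l0 by simp
    ultimately have "multiplicity l (fact (l * Suc a) :: nat) =
        Suc (multiplicity l (Suc a)) + (a + multiplicity l (fact a :: nat))"
      using l l0 prime_elem_multiplicity_mult_distrib[of l "l * Suc a" "fact (l * a + (l - 1))"]
        multiplicity_times_same[where p = l and x = "Suc a"] prime_gt_1_nat[OF l]
      by (simp del: mult_Suc_right)
    moreover have "multiplicity l (fact (Suc a) :: nat) =
        multiplicity l (Suc a) + multiplicity l (fact a :: nat)"
      using l prime_elem_multiplicity_mult_distrib[of l "Suc a" "fact a"] by simp
    ultimately show ?case by simp
  qed
  then show ?thesis using step assms(2) by blast
qed

text \<open>Induction on the number of digits, removing the last one: the previous lemma turns the
  factorial of the number into that of its quotient by \<open>l\<close>, and applied to each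
  \<open>l ^ Suc i\<close> it yields the matching extra summands \<open>l ^ i\<close>.\<close>

lemma multiplicity_fact_base_expression:
  fixes l :: nat
  assumes l: "prime l" and "\<forall>i\<le>k. b i < l"
  shows "multiplicity l (fact (\<Sum>i\<le>k. b i * l ^ i) :: nat) =
    (\<Sum>i\<le>k. b i * multiplicity l (fact (l ^ i) :: nat))"
  using assms(2)
proof (induction k arbitrary: b)
  case 0
  then show ?case using multiplicity_fact_mult_add[OF l, of "b 0" 0] by simp
next
  case (Suc k)
  \<comment> \<open>This is the quotient by \<open>l\<close>: its digits are those of
    \<open>b\<close> shifted down by one place.\<close>
  let ?a = "\<Sum>i\<le>k. b (Suc i) * l ^ i"
  have l0: "0 < l" using l prime_gt_0_nat by blast
  have "multiplicity l (fact (l ^ Suc i) :: nat) = l ^ i + multiplicity l (fact (l ^ i) :: nat)" for i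
    using multiplicity_fact_mult_add[OF l l0, of "l ^ i"] by simp
  then have "(\<Sum>i\<le>k. b (Suc i) * multiplicity l (fact (l ^ Suc i) :: nat)) =
      ?a + (\<Sum>i\<le>k. b (Suc i) * multiplicity l (fact (l ^ i) :: nat))"
    by (simp add: distrib_left sum.distrib)
  moreover have "(\<Sum>i\<le>Suc k. b i * l ^ i) = l * ?a + b 0"
    by (simp only: sum.atMost_Suc_shift) (simp add: sum_distrib_left mult_ac)
  moreover have "multiplicity l (fact (l * ?a + b 0) :: nat) = ?a + multiplicity l (fact ?a :: nat)"
    using Suc.prems by (intro multiplicity_fact_mult_add[OF l]) auto
  moreover have "multiplicity l (fact ?a :: nat) =
      (\<Sum>i\<le>k. b (Suc i) * multiplicity l (fact (l ^ i) :: nat))"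
    using Suc.prems by (intro Suc.IH) auto
  ultimately show ?case by (simp only: sum.atMost_Suc_shift) simp
qed

section \<open>Counting the permutations that preserve every block\<close>

definition block_perms :: "'a set set \<Rightarrow> ('a \<Rightarrow> 'a) set" where
  "block_perms \<B> = {\<pi>. \<pi> permutes \<Union>\<B> \<and> (\<forall>X\<in>\<B>. \<pi> ` X = X)}"

text \<open>Induction step for the count: the two factors have disjoint supports, so the composite
  determines both.\<close>

lemma block_perms_insert:
  assumes dj: "X \<inter> \<Union>\<F> = {}"
  shows "bij_betw (\<lambda>(\<sigma>, \<tau>). \<sigma> \<circ> \<tau>) ({\<sigma>. \<sigma> permutes X} \<times> block_perms \<F>)
    (block_perms (insert X \<F>))"
proof (rule bij_betwI')
  fix p q
  assume "p \<in> {\<sigma>. \<sigma> permutes X} \<times> block_perms \<F>" "q \<in> {\<sigma>. \<sigma> permutes X} \<times> block_perms \<F>"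
  then obtain \<sigma> \<tau> \<sigma>' \<tau>' where p: "p = (\<sigma>, \<tau>)" "\<sigma> permutes X" "\<tau> permutes \<Union>\<F>"
    and q: "q = (\<sigma>', \<tau>')" "\<sigma>' permutes X" "\<tau>' permutes \<Union>\<F>"
    by (auto simp: block_perms_def)
  have "p = q" if eq: "\<sigma> \<circ> \<tau> = \<sigma>' \<circ> \<tau>'"
  proof -
    have "\<sigma> x = \<sigma>' x" for x
    proof (cases "x \<in> X")
      case True
      then have "x \<notin> \<Union>\<F>" using dj by blast
      then have "\<tau> x = x" "\<tau>' x = x" using permutes_not_in[OF p(3)] permutes_not_in[OF q(3)] by blast+
      then show ?thesis using fun_cong[OF eq, of x] by simp
    next
      case False
      then show ?thesis using p(2) q(2) by (simp add: permutes_def)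
    qed
    then have "\<sigma> = \<sigma>'" by blast
    moreover from this have "\<tau> x = \<tau>' x" for x
      using fun_cong[OF eq, of x] permutes_inj[OF p(2)] by (simp add: inj_eq)
    ultimately show ?thesis using p q by auto
  qed
  then show "((case p of (\<sigma>, \<tau>) \<Rightarrow> \<sigma> \<circ> \<tau>) = (case q of (\<sigma>, \<tau>) \<Rightarrow> \<sigma> \<circ> \<tau>)) = (p = q)"
    using p q by auto
next
  fix p assume "p \<in> {\<sigma>. \<sigma> permutes X} \<times> block_perms \<F>"
  then obtain \<sigma> \<tau> where p: "p = (\<sigma>, \<tau>)" "\<sigma> permutes X" "\<tau> permutes \<Union>\<F>"
    "\<And>Y. Y \<in> \<F> \<Longrightarrow> \<tau> ` Y = Y"
    by (auto simp: block_perms_def)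
  have "\<sigma> permutes \<Union>(insert X \<F>)" "\<tau> permutes \<Union>(insert X \<F>)"
    using p(2,3) by (auto elim!: permutes_subset)
  then have "\<sigma> \<circ> \<tau> permutes \<Union>(insert X \<F>)" by (intro permutes_compose)
  moreover have "(\<sigma> \<circ> \<tau>) ` X = X"
  proof -
    have "\<tau> x = x" if "x \<in> X" for x
      using dj that by (intro permutes_not_in[OF p(3)]) blast
    then have "\<tau> ` X = X" by (simp cong: image_cong)
    then show ?thesis using permutes_image[OF p(2)] by (metis image_comp)
  qed
  moreover have "(\<sigma> \<circ> \<tau>) ` Y = Y" if "Y \<in> \<F>" for Y
  proof -
    have "\<sigma> y = y" if "y \<in> Y" for y using dj p(2) that \<open>Y \<in> \<F>\<close> by (auto simp: permutes_def)
    then have "\<sigma> ` Y = Y" by (simp cong: image_cong)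
    then show ?thesis using p(4)[OF that] by (metis image_comp)
  qed
  ultimately show "(case p of (\<sigma>, \<tau>) \<Rightarrow> \<sigma> \<circ> \<tau>) \<in> block_perms (insert X \<F>)"
    by (auto simp: p(1) block_perms_def)
next
  fix \<pi> assume "\<pi> \<in> block_perms (insert X \<F>)"
  then have \<pi>: "\<pi> permutes X \<union> \<Union>\<F>" "\<pi> ` X = X" "\<And>Y. Y \<in> \<F> \<Longrightarrow> \<pi> ` Y = Y"
    by (auto simp: block_perms_def)
  \<comment> \<open>The restriction of \<open>\<pi>\<close> to \<open>X\<close>, extended by the
    identity. Removing it from \<open>\<pi>\<close> on the left leaves a permutation that fixes
    \<open>X\<close> pointwise.\<close>
  define \<sigma> where "\<sigma> = (\<lambda>x. if x \<in> X then \<pi> x else x)"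
  have "bij_betw \<sigma> X X"
    using \<pi>(2) permutes_inj[OF \<pi>(1)]
    by (auto simp: bij_betw_def \<sigma>_def inj_on_def inj_def)
  then have \<sigma>: "\<sigma> permutes X" by (rule bij_imp_permutes) (simp add: \<sigma>_def)
  define \<tau> where "\<tau> = inv_into UNIV \<sigma> \<circ> \<pi>"
  have inv_fix: "inv_into UNIV \<sigma> x = x" if "x \<notin> X" for x
    using permutes_inv[OF \<sigma>] that by (simp add: permutes_def)
  have "\<tau> permutes X \<union> \<Union>\<F>"
    unfolding \<tau>_def by (intro permutes_compose[OF \<pi>(1)] permutes_subset[OF permutes_inv[OF \<sigma>]]) auto
  moreover have "\<tau> x = x" if "x \<in> X" for x
  proof -
    have "\<pi> x = \<sigma> x" using that by (simp add: \<sigma>_def)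
    then show ?thesis using permutes_inverses(2)[OF \<sigma>] by (simp add: \<tau>_def)
  qed
  ultimately have "\<tau> permutes \<Union>\<F>" by (elim permutes_superset) auto
  moreover have "\<tau> ` Y = Y" if "Y \<in> \<F>" for Y
  proof -
    have "inv_into UNIV \<sigma> y = y" if "y \<in> Y" for y
      using inv_fix dj that \<open>Y \<in> \<F>\<close> by blast
    then have "inv_into UNIV \<sigma> ` Y = Y" by (simp cong: image_cong)
    then show ?thesis using \<pi>(3)[OF that] by (metis \<tau>_def image_comp)
  qed
  moreover have "\<pi> = \<sigma> \<circ> \<tau>"
    using permutes_inverses(1)[OF \<sigma>] by (simp add: \<tau>_def fun_eq_iff)
  ultimately show "\<exists>p\<in>{\<sigma>. \<sigma> permutes X} \<times> block_perms \<F>. \<pi> = (case p of (\<sigma>, \<tau>) \<Rightarrow> \<sigma> \<circ> \<tau>)"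
    using \<sigma> by (intro bexI[of _ "(\<sigma>, \<tau>)"]) (auto simp: block_perms_def)
qed

lemma card_block_perms:
  assumes "finite \<B>" and "disjoint \<B>" and "\<And>X. X \<in> \<B> \<Longrightarrow> finite X"
  shows "card (block_perms \<B>) = (\<Prod>X\<in>\<B>. fact (card X))"
  using assms
proof (induction \<B> rule: finite_induct)
  case empty
  then show ?case by (simp add: block_perms_def)
next
  case (insert X \<F>)
  have "X \<inter> \<Union>\<F> = {}" using insert.prems(1) insert.hyps(2) by (auto simp: disjoint_def)
  then have "card (block_perms (insert X \<F>)) = card ({\<sigma>. \<sigma> permutes X} \<times> block_perms \<F>)"
    by (metis bij_betw_same_card block_perms_insert)
  moreover have "disjoint \<F>" using insert.prems(1) by (rule pairwise_subset) auto
  ultimately show ?case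
    using insert by (simp add: card_cartesian_product card_permutations)
qed

text \<open>The order is the product of the factorials of the block sizes. Grouping blocks by size
  turns its multiplicity into the digit sum found for the factorial of
  \<open>CARD('n)\<close>.\<close>

lemma multiplicity_card_block_perms:
  fixes \<B> :: "'n::finite set set" and l :: nat
  assumes l: "prime l" and b: "base_expression l CARD('n) k b" and \<B>: "block_choice l k b \<B>"
  shows "multiplicity l (card (block_perms \<B>)) = multiplicity l (fact CARD('n) :: nat)"
proof -
  let ?v = "\<lambda>i. multiplicity l (fact (l ^ i) :: nat)"
  let ?\<B> = "\<lambda>i. {X\<in>\<B>. card X = l ^ i}"
  have l1: "l > 1" using l prime_gt_1_nat by blast
  have un: "\<B> = (\<Union>i\<in>{1..k}. ?\<B> i)" using \<B> by (auto simp: block_choice_def)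
  have "multiplicity l (card (block_perms \<B>)) = (\<Sum>X\<in>\<B>. multiplicity l (fact (card X) :: nat))"
    using \<B> l by (simp add: card_block_perms block_choice_def prime_elem_multiplicity_prod_distrib
        image_iff)
  \<comment> \<open>The size classes are disjoint because \<open>l > 1\<close> makes the powers
    \<open>l ^ i\<close> distinct.\<close>
  also have "\<dots> = (\<Sum>i=1..k. \<Sum>X\<in>?\<B> i. multiplicity l (fact (card X) :: nat))"
    by (subst un, subst sum.UNION_disjoint) (use l1 in auto)
  also have "\<dots> = (\<Sum>i=1..k. b i * ?v i)"
    using \<B> by (intro sum.cong) (auto simp: block_choice_def)
  \<comment> \<open>The index \<open>0\<close> adds nothing, since \<open>fact (l ^ 0)\<close> is
    \<open>1\<close>.\<close>
  also have "\<dots> = (\<Sum>i\<le>k. b i * ?v i)"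
    by (intro sum.mono_neutral_left) (auto simp: Suc_le_eq)
  also have "\<dots> = multiplicity l (fact CARD('n) :: nat)"
    using multiplicity_fact_base_expression[OF l, of k b] b by (simp add: base_expression_def)
  finally show ?thesis .
qed

section \<open>The block group as a parabolic subgroup\<close>

lemma block_sym_product_eq: "block_sym_product \<B> = perm_map ` block_perms \<B>"
  by (simp add: block_sym_product_def block_perms_def)

lemma block_perms_bij: "\<pi> \<in> block_perms \<B> \<Longrightarrow> bij \<pi>"
  by (auto simp: block_perms_def permutes_bij)

text \<open>The subspace whose pointwise stabiliser turns out to be the block group.\<close>

definition block_constant :: "'n set set \<Rightarrow> (complex ^ 'n) set" where
  "block_constant \<B> = {v. \<forall>X\<in>\<B>. \<forall>x\<in>X. \<forall>y\<in>X. v $ x = v $ y}"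

lemma inv_into_mem:
  assumes "bij \<pi>" "\<pi> ` X = X" "j \<in> X"
  shows "inv_into UNIV \<pi> j \<in> X"
  using assms by (metis bij_is_inj image_iff inv_f_f)

text \<open>For the harder inclusion, two kinds of test vectors suffice: indicators of blocks and
  basis vectors outside the blocks. Fixing them forces all scalars to be \<open>1\<close> and the
  permutation to preserve each block and every outside index.\<close>

lemma block_sym_product_eq_stabilizer:
  fixes \<B> :: "'n::finite set set"
  assumes dj: "disjoint \<B>" and r: "r > 0"
  shows "block_sym_product \<B> = {g \<in> monomial_set r q. \<forall>u\<in>block_constant \<B>. g u = u}"
proof (intro equalityI subsetI)
  fix g assume "g \<in> block_sym_product \<B>"
  then obtain \<pi> where g: "g = perm_map \<pi>" "\<pi> \<in> block_perms \<B>"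
    by (auto simp: block_sym_product_eq)
  have bij: "bij \<pi>" using block_perms_bij g(2) by blast
  have "g u $ j = u $ j" if u: "u \<in> block_constant \<B>" for u j
  proof (cases "j \<in> \<Union>\<B>")
    case True
    then obtain X where X: "X \<in> \<B>" "j \<in> X" by blast
    then have "inv_into UNIV \<pi> j \<in> X"
      using g(2) inv_into_mem[OF bij] by (auto simp: block_perms_def)
    then have "u $ inv_into UNIV \<pi> j = u $ j"
      using X u unfolding block_constant_def by blast
    then show ?thesis by (simp add: g(1) perm_map_nth[OF bij])
  next
    case False
    have "inv_into UNIV \<pi> permutes \<Union>\<B>" using g(2) permutes_inv by (auto simp: block_perms_def)
    then have "inv_into UNIV \<pi> j = j" using False by (rule permutes_not_in)
    then show ?thesis by (simp add: g(1) perm_map_nth[OF bij])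
  qed
  then show "g \<in> {g \<in> monomial_set r q. \<forall>u\<in>block_constant \<B>. g u = u}"
    using g(1) perm_map_in_monomial_set[OF bij] by (auto simp: vec_eq_iff)
next
  fix g assume "g \<in> {g \<in> monomial_set r q. \<forall>u\<in>block_constant \<B>. g u = u}"
  then obtain \<theta> \<pi> where g: "g = monomial_map \<theta> \<pi>" "\<theta> \<in> root_functions r q" "bij \<pi>"
    and fixed: "\<And>u. u \<in> block_constant \<B> \<Longrightarrow> g u = u"
    by (auto simp: monomial_set_def)
  have nz: "\<theta> j \<noteq> 0" for j using root_functions_nonzero g(2) r by blast
  have nth: "\<theta> j * u $ inv_into UNIV \<pi> j = u $ j" if "u \<in> block_constant \<B>" for u j
    using arg_cong[OF fixed[OF that], of "\<lambda>v. v $ j"] by (simp add: g(1) monomial_map_nth[OF g(3)])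
  have block: "(inv_into UNIV \<pi> j \<in> X \<longleftrightarrow> j \<in> X) \<and> (j \<in> X \<longrightarrow> \<theta> j = 1)" if X: "X \<in> \<B>" for X j
  proof -
    have "Y = X \<or> Y \<inter> X = {}" if "Y \<in> \<B>" for Y
      using dj X that by (auto simp: disjoint_def)
    \<comment> \<open>Disjointness makes this indicator constant on the other blocks. That it is
      fixed says that \<open>\<theta> j\<close> times its value at the preimage of \<open>j\<close>
      is its value at \<open>j\<close>.\<close>
    then have "(\<chi> i. if i \<in> X then 1 else 0) \<in> block_constant \<B>"
      unfolding block_constant_def by fastforce
    from nth[OF this, of j] show ?thesis using nz[of j] by (auto split: if_splits)
  qed
  have outside: "inv_into UNIV \<pi> j = j \<and> \<theta> j = 1" if j: "j \<notin> \<Union>\<B>" for j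
  proof -
    have "axis j 1 \<in> block_constant \<B>"
      using j unfolding block_constant_def axis_def by fastforce
    from nth[OF this, of j] show ?thesis by (auto simp: axis_def split: if_splits)
  qed
  have "\<theta> = (\<lambda>_. 1)" using block outside by blast
  then have "g = perm_map \<pi>" by (simp add: g(1) perm_map_eq_monomial_map)
  moreover have "\<pi> permutes \<Union>\<B>"
  proof -
    have "\<pi> j = j" if "j \<notin> \<Union>\<B>" for j
      using outside[OF that] g(3) by (metis bij_is_surj surj_f_inv_f)
    then show ?thesis using g(3) by (simp add: permutes_def bij_iff)
  qed
  moreover have "\<pi> ` X = X" if X: "X \<in> \<B>" for X
  proof -
    have "\<pi> i \<in> X \<longleftrightarrow> i \<in> X" for i using block[OF X, of "\<pi> i"] g(3) by (simp add: bij_is_inj)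
    moreover have "\<exists>i. x = \<pi> i" for x using surjD[OF bij_is_surj[OF g(3)]] .
    ultimately show ?thesis
      by (metis (mono_tags, lifting) image_eqI image_subsetI subsetI subset_antisym)
  qed
  ultimately show "g \<in> block_sym_product \<B>" by (auto simp: block_sym_product_eq block_perms_def)
qed

lemma parabolic_block_sym_product:
  assumes "disjoint \<B>" and "r > 0"
  shows "parabolic_subgroup (GL\<lparr>carrier := monomial_set r q\<rparr>) (block_sym_product \<B>)"
proof -
  have const: "v $ x = v $ y" if "v \<in> block_constant \<B>" "X \<in> \<B>" "x \<in> X" "y \<in> X" for v X x y
    using that unfolding block_constant_def by blast
  have "vec.subspace (block_constant \<B>)"
  proof (rule vec.subspaceI)
    fix v w c assume v: "v \<in> block_constant \<B>" and w: "w \<in> block_constant \<B>"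
    have "(v + w) $ x = (v + w) $ y" if "X \<in> \<B>" "x \<in> X" "y \<in> X" for X x y
      using const[OF v that] const[OF w that] by simp
    then show "v + w \<in> block_constant \<B>" unfolding block_constant_def by blast
  next
    fix c v assume v: "v \<in> block_constant \<B>"
    have "(c *s v) $ x = (c *s v) $ y" if "X \<in> \<B>" "x \<in> X" "y \<in> X" for X x y
      using const[OF v that] by simp
    then show "c *s v \<in> block_constant \<B>" unfolding block_constant_def by blast
  qed (simp add: block_constant_def)
  then show ?thesis
    unfolding parabolic_subgroup_def
    using block_sym_product_eq_stabilizer[OF assms, of q] by auto
qed

text \<open>The transposition of two points of \<open>X\<close> fixes every other block pointwise,
  so it belongs to the block group.\<close>

lemma block_sym_product_orbit:
  assumes "disjoint \<B>" and "X \<in> \<B>" and "x \<in> X"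
  shows "(\<lambda>g. g (axis x 1)) ` block_sym_product \<B> = (\<lambda>y. axis y 1) ` X"
    (is "?L = ?R")
proof (intro equalityI subsetI)
  fix w assume "w \<in> ?L"
  then obtain \<pi> where "\<pi> \<in> block_perms \<B>" "w = axis (\<pi> x) 1"
    by (auto simp: block_sym_product_eq perm_map_axis)
  then show "w \<in> ?R" using assms by (auto simp: block_perms_def)
next
  fix w assume "w \<in> ?R"
  then obtain y where y: "y \<in> X" "w = axis y 1" by blast
  have "Transposition.transpose x y permutes \<Union>\<B>"
    using assms(2,3) y(1) by (intro permutes_swap_id) auto
  moreover have "Transposition.transpose x y ` Y = Y" if Y: "Y \<in> \<B>" for Y
  proof (cases "Y = X")
    case True
    then show ?thesis using permutes_image[OF permutes_swap_id[OF assms(3) y(1)]] by simp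
  next
    case False
    then have "Y \<inter> X = {}" using assms(1,2) Y by (auto simp: disjoint_def)
    then have "Transposition.transpose x y z = z" if "z \<in> Y" for z
      using that assms(3) y(1) by (metis disjoint_iff transpose_apply_other)
    then show ?thesis by (simp cong: image_cong)
  qed
  ultimately have "perm_map (Transposition.transpose x y) \<in> block_sym_product \<B>"
    by (auto simp: block_sym_product_eq block_perms_def)
  moreover have "w = perm_map (Transposition.transpose x y) (axis x 1)"
    by (simp add: y(2) perm_map_axis)
  ultimately show "w \<in> ?L" by blast
qed

section \<open>Sylow subgroups\<close>

lemma card_subgroup_dvd_GL:
  fixes A B :: "(complex ^ 'n \<Rightarrow> complex ^ 'n) set"
  assumes A: "subgroup A GL" and B: "subgroup B GL" and "A \<subseteq> B"
  shows "card A dvd card B"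
proof -
  interpret GL: group "GL :: (complex ^ 'n \<Rightarrow> complex ^ 'n) monoid" by (rule group_GL)
  have "subgroup A (GL\<lparr>carrier := B\<rparr>)" by (rule GL.subgroup_incl[OF A B assms(3)])
  from group.lagrange[OF GL.subgroup_imp_group[OF B] this] show ?thesis
    by (metis dvd_triv_right order_def partial_object.select_convs(1) partial_object.simps(2)
        partial_object.surjective partial_object.update_convs(1))
qed

text \<open>
  A Sylow subgroup \<open>S\<close> of the block group is transitive on each block \<open>X\<close>: point stabilisers
  in the block group have index \<open>card X\<close>, so the \<open>l\<close>-part of their order falls short of
  \<open>card S\<close> by the full factor \<open>card X\<close>.
\<close>

lemma sylow_block_transitive:
  fixes \<B> :: "'n::finite set set"
  assumes l: "prime l" and dj: "disjoint \<B>"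
    and B: "subgroup (block_sym_product \<B>) GL" "finite (block_sym_product \<B>)"
    and S: "subgroup S GL" "S \<subseteq> block_sym_product \<B>"
      "card S = l ^ multiplicity l (card (block_sym_product \<B>))"
    and X: "X \<in> \<B>" "card X = l ^ i" and x: "x \<in> X"
  shows "(\<lambda>g. g (axis x 1)) ` S = (\<lambda>y. axis y 1) ` X"
proof -
  let ?B = "block_sym_product \<B>" and ?v = "axis x (1::complex)"
  let ?M = "multiplicity l (card ?B)"
  have orbB: "(\<lambda>g. g ?v) ` ?B = (\<lambda>y. axis y 1) ` X"
    by (rule block_sym_product_orbit[OF dj X(1) x])
  have "card ((\<lambda>y. axis y (1::complex)) ` X) = l ^ i"
    using X(2) by (subst card_image) (auto simp: inj_on_def axis_eq_axis)
  then have cardB: "l ^ i * card {g \<in> ?B. g ?v = ?v} = card ?B"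
    using orbit_stabilizer_GL[OF B(1), of ?v] orbB by simp
  have "{g \<in> S. g ?v = ?v} \<subseteq> {g \<in> ?B. g ?v = ?v}" using S(2) by blast
  then have dvd: "card {g \<in> S. g ?v = ?v} dvd card {g \<in> ?B. g ?v = ?v}"
    using stabilizer_subgroup_GL[OF S(1), of "{?v}"] stabilizer_subgroup_GL[OF B(1), of "{?v}"]
    by (intro card_subgroup_dvd_GL) simp_all
  have cardS: "card ((\<lambda>g. g ?v) ` S) * card {g \<in> S. g ?v = ?v} = l ^ ?M"
    using orbit_stabilizer_GL[OF S(1), of ?v] S(3) by simp
  have "card ((\<lambda>g. g ?v) ` S) dvd l ^ ?M" "card {g \<in> S. g ?v = ?v} dvd l ^ ?M"
    unfolding cardS[symmetric] by (rule dvd_triv_left, rule dvd_triv_right)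
  then obtain a c where ac: "card ((\<lambda>g. g ?v) ` S) = l ^ a" "card {g \<in> S. g ?v = ?v} = l ^ c"
    unfolding divides_primepow_nat[OF l] by blast
  have l1: "l > 1" using l prime_gt_1_nat by blast
  have "l ^ (a + c) = l ^ ?M" using cardS ac by (simp add: power_add)
  then have acM: "a + c = ?M" using l1 by (simp only: power_inject_exp)
  \<comment> \<open>The stabiliser in \<open>S\<close>, of order \<open>l ^ c\<close>, divides the
    stabiliser in the block group, which has index \<open>l ^ i\<close> there.\<close>
  have "l ^ (i + c) dvd card ?B"
    unfolding cardB[symmetric] power_add using dvd[unfolded ac(2)]
    by (rule mult_dvd_mono[OF dvd_refl])
  moreover have "card ?B \<noteq> 0"
    using subgroup.one_closed[OF B(1)] B(2) by (auto simp: card_eq_0_iff)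
  ultimately have "i + c \<le> ?M"
    using l1 by (simp add: power_dvd_iff_le_multiplicity)
  \<comment> \<open>Cancelling \<open>c\<close> from \<open>i + c \<le> a + c\<close> shows that the
    orbit under \<open>S\<close> is at least as large as \<open>X\<close>; it is also contained in
    the orbit given by \<open>X\<close>.\<close>
  then have "l ^ i \<le> l ^ a" using acM l1 by simp
  moreover have "(\<lambda>g. g ?v) ` S \<subseteq> (\<lambda>y. axis y 1) ` X" using orbB S(2) by blast
  ultimately show ?thesis
    using \<open>card ((\<lambda>y. axis y (1::complex)) ` X) = l ^ i\<close> ac(1)
    by (intro card_seteq) auto
qed

text \<open>An element of \<open>S\<close> that moves \<open>axis x 1\<close> to
  \<open>axis y 1\<close> carries coordinate \<open>x\<close> of \<open>v\<close> to coordinate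
  \<open>y\<close>, so invariance makes the two equal.\<close>

lemma block_constant_if_fixed:
  assumes tr: "\<And>X x. X \<in> \<B> \<Longrightarrow> x \<in> X \<Longrightarrow> (\<lambda>g. g (axis x 1)) ` S = (\<lambda>y. axis y 1) ` X"
    and S: "S \<subseteq> block_sym_product \<B>" and v: "\<forall>g\<in>S. g v = v"
  shows "v \<in> block_constant \<B>"
proof -
  have "v $ x = v $ y" if X: "X \<in> \<B>" "x \<in> X" "y \<in> X" for X x y
  proof -
    have "axis y 1 \<in> (\<lambda>g. g (axis x 1)) ` S" using tr[OF X(1,2)] X(3) by simp
    then obtain g where g: "g \<in> S" "axis y 1 = g (axis x 1)" by blast
    then obtain \<pi> where "\<pi> \<in> block_perms \<B>" "g = perm_map \<pi>"
      using S by (auto simp: block_sym_product_eq)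
    then have \<pi>: "g = perm_map \<pi>" "bij \<pi>" by (simp_all add: block_perms_bij)
    then have "y = \<pi> x" using g(2) by (simp add: perm_map_axis axis_eq_axis)
    moreover have "g v $ y = v $ y" by (rule arg_cong[OF bspec[OF v g(1)]])
    ultimately show ?thesis using \<pi> by (simp add: perm_map_nth bij_is_inj)
  qed
  then show ?thesis unfolding block_constant_def by blast
qed

section \<open>The case where the prime does not divide \<open>m\<close>\<close>

lemma multiplicity_order_monomial:
  assumes l: "prime l" and r: "r > 0" and ndvd: "\<not> l dvd r"
  shows "multiplicity l (card (monomial_set r q :: (complex ^ 'n \<Rightarrow> complex ^ 'n) set)) =
    multiplicity l (fact CARD('n) :: nat)"
proof -
  let ?R = "root_functions r q :: ('n \<Rightarrow> complex) set"
  have "\<not> l dvd card ?R"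
    using card_root_functions_dvd[OF r, of q, where 'n = 'n] l ndvd
    by (meson dvd_trans prime_dvd_power)
  moreover have "card ?R \<noteq> 0"
    using card_root_functions(2)[OF r, of q, where 'n = 'n] root_functions_one[of r q]
    by (auto simp: card_eq_0_iff)
  ultimately show ?thesis
    using l by (simp add: card_monomial_set(1)[OF r] prime_elem_multiplicity_mult_distrib
        not_dvd_imp_multiplicity_0)
qed

lemma sylow_parabolic_class_coprime:
  fixes \<B> :: "'n::finite set set"
  assumes l: "prime l" and r: "r > 0" and ndvd: "\<not> l dvd r"
    and b: "base_expression l CARD('n) k b" and \<B>: "block_choice l k b \<B>"
    and G: "G = GL\<lparr>carrier := monomial_set r q\<rparr>"
  shows "sylow_parabolic_class l G = conjugates G (block_sym_product \<B>)"
proof -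
  let ?B = "block_sym_product \<B>"
  interpret finite_linear_group "monomial_set r q" G
    unfolding G by (rule finite_linear_group_monomial_set[OF r])
  have dj: "disjoint \<B>" using \<B> by (simp add: block_choice_def)
  have P: "parabolic_subgroup G ?B" unfolding G by (rule parabolic_block_sym_product[OF dj r])
  note B = parabolic_imp_subgroup[OF P]
  have finB: "finite ?B" using B(3) fin finite_subset by blast
  have "card ?B = card (block_perms \<B>)"
    unfolding block_sym_product_eq by (rule card_image[OF inj_on_perm_map])
  then have mult: "multiplicity l (card ?B) = multiplicity l (order G)"
    using multiplicity_card_block_perms[OF l b \<B>]
      multiplicity_order_monomial[OF l r ndvd, of q, where 'n = 'n]
    by (simp add: order_def)
  \<comment> \<open>The Sylow subgroup is chosen inside the block group; since both orders have the
    same \<open>l\<close>-part by \<open>mult\<close>, it is a Sylow subgroup of \<open>G\<close> as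
    well.\<close>
  obtain c where "order (GL\<lparr>carrier := ?B\<rparr>) = l ^ multiplicity l (card ?B) * c"
    using multiplicity_dvd[of l "card ?B"] by (auto simp: order_def dvd_def)
  then obtain S where S: "subgroup S (GL\<lparr>carrier := ?B\<rparr>)" "card S = l ^ multiplicity l (card ?B)"
    using sylow_thm[OF l group.subgroup_imp_group[OF group_GL B(1)]] finB by auto
  have SGL: "subgroup S GL" by (rule group.incl_subgroup[OF group_GL B(1) S(1)])
  have SB: "S \<subseteq> ?B" using subgroup.subset[OF S(1)] by simp
  have "subgroup S G"
    unfolding G using SB B(3) by (intro group.subgroup_incl[OF group_GL SGL H]) auto
  then have syl: "sylow_subgroup l G S" using S(2) mult by (simp add: sylow_subgroup_def)
  show ?thesis
  proof (rule sylow_parabolic_class_eq_conjugates[OF l P syl SB])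
    fix v assume v: "\<forall>g\<in>S. g v = v"
    have "(\<lambda>g. g (axis x 1)) ` S = (\<lambda>y. axis y 1) ` X" if X: "X \<in> \<B>" "x \<in> X" for X x
    proof -
      obtain i where "card X = l ^ i" using \<B> X(1) by (auto simp: block_choice_def)
      from sylow_block_transitive[OF l dj B(1) finB SGL SB S(2) X(1) this X(2)] show ?thesis .
    qed
    then have "v \<in> block_constant \<B>" using SB v by (rule block_constant_if_fixed)
    then show "\<forall>g\<in>?B. g v = v" using block_sym_product_eq_stabilizer[OF dj r, of q] by blast
  qed
qed

section \<open>The case where the prime divides \<open>m\<close>\<close>

text \<open>
  The \<open>l\<close>-torsion of the diagonal subgroup is normal of \<open>l\<close>-power order, hence contained in
  every Sylow subgroup.
\<close>

lemma diag_map_in_sylow: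
  fixes S :: "(complex ^ 'n \<Rightarrow> complex ^ 'n) set"
  assumes l: "prime l" and r: "r > 0" and dvd: "l dvd r"
    and G: "G = GL\<lparr>carrier := monomial_set r q\<rparr>"
    and S: "sylow_subgroup l G S" and \<theta>: "\<theta> \<in> root_functions l q"
  shows "diag_map \<theta> \<in> S"
proof -
  interpret finite_linear_group "monomial_set r q" G
    unfolding G by (rule finite_linear_group_monomial_set[OF r])
  interpret GL: group "GL :: (complex ^ 'n \<Rightarrow> complex ^ 'n) monoid" by (rule group_GL)
  let ?R = "root_functions l q :: ('n \<Rightarrow> complex) set"
  let ?N = "diag_map ` ?R"
  have l0: "l > 0" using l prime_gt_0_nat by blast
  have "?R \<subseteq> root_functions r q"
    using dvd by (auto simp: root_functions_def dvd_def power_mult)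
  then have NH: "?N \<subseteq> monomial_set r q"
    unfolding monomial_set_def diag_map_eq_monomial_map using bij_id by blast
  have comp: "diag_map \<theta> \<circ> diag_map \<eta> = diag_map (\<lambda>i. \<theta> i * \<eta> i)" for \<theta> \<eta> :: "'n \<Rightarrow> complex"
    by (simp add: fun_eq_iff vec_eq_iff)
  have nz: "\<theta> i \<noteq> 0" if "\<theta> \<in> ?R" for \<theta> i using root_functions_nonzero[OF that l0] .
  have "subgroup ?N G"
  proof (rule subgroupI)
    show "?N \<noteq> {}" using \<theta> by blast
    show "inv\<^bsub>G\<^esub> g \<in> ?N" if "g \<in> ?N" for g
    proof -
      from that obtain \<eta> where \<eta>: "g = diag_map \<eta>" "\<eta> \<in> ?R" by blast
      have "diag_map (\<lambda>i. inverse (\<eta> i)) \<circ> g = id"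
        using nz[OF \<eta>(2)] by (simp add: \<eta>(1) fun_eq_iff vec_eq_iff)
      then have "inv\<^bsub>G\<^esub> g = diag_map (\<lambda>i. inverse (\<eta> i))"
        using NH that root_functions_inverse[OF \<eta>(2)] by (intro inv_equality) auto
      then show ?thesis using root_functions_inverse[OF \<eta>(2)] by blast
    qed
  qed (use NH in \<open>auto simp: comp root_functions_mult\<close>)
  have "inj_on diag_map ?R"
  proof (rule inj_onI)
    fix \<theta> \<eta> :: "'n \<Rightarrow> complex" assume "\<theta> \<in> ?R" "diag_map \<theta> = diag_map \<eta>"
    then show "\<theta> = \<eta>"
      using monomial_map_inject(1)[of \<theta> id \<eta> id] nz unfolding diag_map_eq_monomial_map by auto
  qed
  then have "card ?N dvd l ^ CARD('n)"
    using card_root_functions_dvd[OF l0, of q, where 'n = 'n] by (simp add: card_image)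
  then obtain a where "card ?N = l ^ a" using divides_primepow_nat[OF l] by blast
  \<comment> \<open>The torsion group has \<open>l\<close>-power order, so some \<open>h\<close>
    conjugates it into \<open>S\<close>.\<close>
  with sylow_subgroup_index[OF _ l S] S \<open>subgroup ?N G\<close> l fin
  obtain h where h: "h \<in> monomial_set r q" "\<And>g. g \<in> ?N \<Longrightarrow> h \<circ> g \<circ> inv_into UNIV h \<in> S"
    using prime_power_subgroup_conj_into[of l S ?N a] by (auto simp: sylow_subgroup_def)
  obtain \<eta> \<pi> where \<pi>: "h = monomial_map \<eta> \<pi>" "\<eta> \<in> root_functions r q" "bij \<pi>"
    using h(1) by (auto simp: monomial_set_def)
  \<comment> \<open>This is normality: \<open>diag_map \<theta>\<close> is the conjugate by
    \<open>h\<close> of the diagonal map with entries relabelled by \<open>\<pi>\<close>, which is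
    again torsion.\<close>
  have "h \<circ> diag_map (\<lambda>i. \<theta> (\<pi> i)) = diag_map \<theta> \<circ> h"
    using \<pi>(3) by (simp add: \<pi>(1) fun_eq_iff vec_eq_iff monomial_map_nth bij_is_surj surj_f_inv_f)
  then have "h \<circ> diag_map (\<lambda>i. \<theta> (\<pi> i)) \<circ> inv_into UNIV h = diag_map \<theta> \<circ> (h \<circ> inv_into UNIV h)"
    by (simp add: o_assoc)
  also have "\<dots> = diag_map \<theta>" using h(1) by (simp add: fun_eq_iff)
  finally show ?thesis using h(2)[OF imageI[OF root_functions_permute[OF \<theta> \<pi>(3)]]] by simp
qed

text \<open>The whole group is the stabiliser of the zero subspace, and a Sylow subgroup fixes only
  the zero vector, so the conjugacy criterion applies with \<open>P\<close> the whole group.\<close>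

lemma sylow_parabolic_class_dvd:
  fixes G :: "(complex ^ 'n \<Rightarrow> complex ^ 'n) monoid"
  assumes l: "prime l" and r: "r > 0" and dvd: "l dvd r" and n: "CARD('n) > 1"
    and G: "G = GL\<lparr>carrier := monomial_set r q\<rparr>"
  shows "sylow_parabolic_class l G = {carrier G}"
proof -
  interpret finite_linear_group "monomial_set r q" G
    unfolding G by (rule finite_linear_group_monomial_set[OF r])
  let ?H = "monomial_set r q :: (complex ^ 'n \<Rightarrow> complex ^ 'n) set"
  have zero: "h 0 = 0" if "h \<in> ?H" for h
    using linear[OF that] by (rule vec.linear_0)
  then have "?H = {g \<in> ?H. \<forall>u\<in>{0}. g u = u}" by auto
  then have P: "parabolic_subgroup G ?H"
    unfolding parabolic_subgroup_def carrier using vec.subspace_single_0 by blast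
  obtain c where "order G = l ^ multiplicity l (order G) * c"
    using multiplicity_dvd[of l "order G"] by (auto simp: dvd_def)
  then obtain S where "subgroup S G" "card S = l ^ multiplicity l (order G)"
    using sylow_thm[OF l is_group] fin by auto
  then have S: "sylow_subgroup l G S" by (simp add: sylow_subgroup_def)
  have SH: "S \<subseteq> ?H" using S subgroup.subset by (fastforce simp: sylow_subgroup_def)
  have l1: "l > 1" using l prime_gt_1_nat by blast
  have "card {z::complex. z ^ l = 1} = l" using l1 by (simp add: card_roots_unity_eq)
  then have "{z::complex. z ^ l = 1} \<noteq> {1}" using l1 by auto
  then obtain z :: complex where z: "z ^ l = 1" "z \<noteq> 1" by fastforce
  then have z0: "z \<noteq> 0" using l1 by (auto simp: power_0_left)
  have trivial: "v = 0" if v: "\<forall>g\<in>S. g v = v" for v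
  proof -
    have "v $ i = 0" for i
    proof -
      obtain j where j: "j \<noteq> i" using n by (metis (full_types) UNIV_I card_1_singleton_iff
          is_singletonI' is_singleton_altdef less_irrefl UNIV_not_empty)
      \<comment> \<open>Placing \<open>z\<close> at \<open>i\<close> and its inverse at a second
        index makes the product \<open>1\<close> for every \<open>q\<close>. The second index exists
        because \<open>CARD('n) > 1\<close>.\<close>
      define \<theta> where "\<theta> = (\<lambda>k. if k = i then z else if k = j then inverse z else 1)"
      have "(\<Prod>k\<in>UNIV. \<theta> k ^ q) = (\<Prod>k\<in>{i, j}. \<theta> k ^ q)"
        by (rule prod.mono_neutral_right) (auto simp: \<theta>_def)
      also have "\<dots> = 1" using j z0 by (simp add: \<theta>_def power_inverse)
      finally have "\<theta> \<in> root_functions l q"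
        using z(1) by (auto simp: root_functions_def \<theta>_def power_inverse)
      then have "diag_map \<theta> v = v" using diag_map_in_sylow[OF l r dvd G S] v by blast
      then have "z * v $ i = v $ i" by (metis diag_map_nth \<theta>_def)
      then show ?thesis using z(2) by simp
    qed
    then show ?thesis by (simp add: vec_eq_iff)
  qed
  have "sylow_parabolic_class l G = conjugates G ?H"
    by (rule sylow_parabolic_class_eq_conjugates[OF l P S SH]) (use trivial zero in auto)
  also have "\<dots> = {conj_set h ?H | h. h \<in> ?H}" by (rule conjugates_eq) simp
  also have "\<dots> = {?H}"
  proof -
    \<comment> \<open>A conjugate of the whole group lies in it and has the same finite
      cardinality.\<close>
    have "conj_set h ?H = ?H" if h: "h \<in> ?H" for h
    proof (rule card_subset_eq[OF fin _ card_conj_set[OF h]])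
      show "conj_set h ?H \<subseteq> ?H"
        using parabolic_imp_subgroup(3)[OF parabolic_conj_set[OF P h]] .
    qed
    moreover have "id \<in> ?H" using one_closed by simp
    ultimately show ?thesis by blast
  qed
  finally show ?thesis by simp
qed

theorem theorem3p3:
  fixes m p l k :: nat and b :: "nat \<Rightarrow> nat"
    and G :: "(complex ^ 'n \<Rightarrow> complex ^ 'n) monoid"
  assumes "m > 1" and "CARD('n) > 1" and "p \<ge> 1" and "p dvd m"
    and "G = imprim_group m p"
    and "prime l" and "l dvd Coset.order G"
    and "base_expression l CARD('n) k b"
  shows "(l dvd m \<longrightarrow> sylow_parabolic_class l G = {carrier G}) \<and>
         (\<not> l dvd m \<longrightarrow>
           (\<forall>\<B>. block_choice l k b \<B> \<longrightarrow>
              sylow_parabolic_class l G = conjugates G (block_sym_product \<B>)))"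
proof (intro conjI impI allI)
  \<comment> \<open>Both cases are proved for an arbitrary exponent \<open>q\<close> in the product
    condition; here it is \<open>m div p\<close>.\<close>
  have m: "m > 0" and G: "G = GL\<lparr>carrier := monomial_set m (m div p)\<rparr>"
    using assms(1,5) by (simp_all add: imprim_group_eq)
  show "sylow_parabolic_class l G = {carrier G}" if "l dvd m"
    by (rule sylow_parabolic_class_dvd[OF assms(6) m that assms(2) G])
  show "sylow_parabolic_class l G = conjugates G (block_sym_product \<B>)"
    if "\<not> l dvd m" "block_choice l k b \<B>" for \<B>
    by (rule sylow_parabolic_class_coprime[OF assms(6) m that(1) assms(8) that(2) G])
qed

end
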